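(* Let $1\le k\le n$ and $m\ge1$ be integers. For any $H\in\mathbf{H}_n$ and any $\{p_j\}_{j=1}^m\subset[0,1]$ such that $\sum_{j=1}^mp_j\le1$, the function $$(A^{(1)},A^{(2)},\dots,A^{(m)})\ \longmapsto\ \phi\Big(\exp\Big(H+\sum_{j=1}^mp_j\log A^{(j)}\Big)\Big)$$ is jointly concave on $(\mathbf{H}_n^{++})^{\times m}$. In particular, $A\mapsto\phi\big(\exp(H+\log A)\big)$ is concave on $\mathbf{H}_n^{++}$.
   Context: $\mathbf{H}_n$ is the space of $n\times n$ Hermitian matrices and $\mathbf{H}_n^{++}$ the convex cone of $n\times n$ Hermitian positive definite matrices; $(\mathbf{H}_n^{++})^{\times m}$ is the $m$-fold Cartesian product. For $X\in\mathbb{C}^{n\times n}$, $\mathrm{Tr}_k[X]$ denotes the $k$-th elementary symmetric polynomial of the eigenvalues of $X$ (equivalently, the sum of all $k\times k$ principal minors of $X$), and $\phi(X)=(\mathrm{Tr}_k[X])^{1/k}$ for the fixed integer $k$. $\exp$ and $\log$ of Hermitian matrices are defined by the spectral functional calculus. *)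

theory Defs
  imports "HOL-Analysis.Analysis" "HOL-Computational_Algebra.Fundamental_Theorem_Algebra"
begin

definition adjoint_mat :: "complex^'n^'m \<Rightarrow> complex^'m^'n"
  where "adjoint_mat A = (\<chi> i j. cnj (A $ j $ i))"

definition unitary_mat :: "complex^'n^'n \<Rightarrow> bool"
  where "unitary_mat U \<longleftrightarrow> adjoint_mat U ** U = mat 1 \<and> U ** adjoint_mat U = mat 1"

definition Herm :: "(complex^'n^'n) set"
  where "Herm = {A. adjoint_mat A = A}"

text \<open>For a Hermitian matrix the quadratic form below is real-valued, so taking its real part
  loses nothing.\<close>

definition HPD :: "(complex^'n^'n) set"
  where "HPD = {A \<in> Herm. \<forall>x. x \<noteq> 0 \<longrightarrow> 0 < Re (\<Sum>i\<in>UNIV. cnj (x $ i) * (A *v x) $ i)}"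

definition diag_real :: "('n \<Rightarrow> real) \<Rightarrow> complex^'n^'n"
  where "diag_real d = (\<chi> i j. if i = j then complex_of_real (d i) else 0)"

text \<open>Spectral functional calculus: \<open>f (U diag(d) U\<^sup>*) = U diag(f \<circ> d) U\<^sup>*\<close> for unitary \<open>U\<close> and real \<open>d\<close>.
  The value does not depend on the diagonalisation, see \<open>herm_fun_diag\<close> below; it is meaningful
  for Hermitian arguments only.\<close>

definition herm_fun :: "(real \<Rightarrow> real) \<Rightarrow> complex^'n^'n \<Rightarrow> complex^'n^'n"
  where "herm_fun f A = (THE B. \<exists>U d. unitary_mat U \<and> A = U ** diag_real d ** adjoint_mat U
                                  \<and> B = U ** diag_real (\<lambda>i. f (d i)) ** adjoint_mat U)"

abbreviation herm_exp :: "complex^'n^'n \<Rightarrow> complex^'n^'n"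
  where "herm_exp \<equiv> herm_fun exp"

abbreviation herm_log :: "complex^'n^'n \<Rightarrow> complex^'n^'n"
  where "herm_log \<equiv> herm_fun ln"

definition charpoly :: "complex^'n^'n \<Rightarrow> complex poly"
  where "charpoly A = det (\<chi> i j. (if i = j then [:0, 1:] else 0) - [:A $ i $ j:])"

text \<open>An enumeration of the eigenvalues, each one repeated according to its algebraic multiplicity;
  the order is arbitrary. It exists by \<open>charpoly_eigenvalues\<close> below.\<close>

definition eigenvalues :: "complex^'n^'n \<Rightarrow> 'n \<Rightarrow> complex"
  where "eigenvalues A = (SOME e. charpoly A = (\<Prod>i\<in>UNIV. [:- e i, 1:]))"

definition Tr_k :: "nat \<Rightarrow> complex^'n^'n \<Rightarrow> complex"
  where "Tr_k k A = (\<Sum>I | card I = k. \<Prod>i\<in>I. eigenvalues A i)"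

text \<open>\<open>\<phi>(A) = (Tr\<^sub>k[A])\<^bsup>1/k\<^esup>\<close>. It is only applied to positive definite matrices, where \<^term>\<open>Tr_k k A\<close> is a
  positive real number (for \<open>k\<close> at most the size of \<open>A\<close>).\<close>

definition phi :: "nat \<Rightarrow> complex^'n^'n \<Rightarrow> real"
  where "phi k A = root k (Re (Tr_k k A))"

lemma herm_fun_diag:
  fixes U :: "complex^'n^'n"
  assumes U: "unitary_mat U" and A: "A = U ** diag_real d ** adjoint_mat U"
  shows "herm_fun f A = U ** diag_real (\<lambda>i. f (d i)) ** adjoint_mat U"
  unfolding herm_fun_def
proof (rule the_equality)
  show "\<exists>U' d'. unitary_mat U' \<and> A = U' ** diag_real d' ** adjoint_mat U' \<and>
      U ** diag_real (\<lambda>i. f (d i)) ** adjoint_mat U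
        = U' ** diag_real (\<lambda>i. f (d' i)) ** adjoint_mat U'"
    using U A by blast
next
  fix B assume "\<exists>V e. unitary_mat V \<and> A = V ** diag_real e ** adjoint_mat V \<and>
      B = V ** diag_real (\<lambda>i. f (e i)) ** adjoint_mat V"
  then obtain V e where V: "unitary_mat V" "A = V ** diag_real e ** adjoint_mat V"
    and B: "B = V ** diag_real (\<lambda>i. f (e i)) ** adjoint_mat V" by blast
  define W where "W = adjoint_mat V ** U"
  have entry_r: "(W ** diag_real g) $ i $ j = W $ i $ j * complex_of_real (g j)" for g i j
    by (simp add: matrix_matrix_mult_def diag_real_def if_distrib cong: if_cong)
  have entry_l: "(diag_real g ** W) $ i $ j = complex_of_real (g i) * W $ i $ j" for g i j
    by (simp add: matrix_matrix_mult_def diag_real_def if_distrib[of "\<lambda>x. x * y" for y] cong: if_cong)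
  have "W ** diag_real d = adjoint_mat V ** (U ** diag_real d ** adjoint_mat U) ** U"
    using U unfolding W_def unitary_mat_def by (metis matrix_mul_assoc matrix_mul_rid)
  also have "\<dots> = adjoint_mat V ** (V ** diag_real e ** adjoint_mat V) ** U"
    using A V(2) by simp
  also have "\<dots> = diag_real e ** W"
    using V(1) unfolding W_def unitary_mat_def by (metis matrix_mul_assoc matrix_mul_lid)
  finally have comm: "W $ i $ j * complex_of_real (d j) = complex_of_real (e i) * W $ i $ j" for i j
    using entry_r entry_l by metis
  have "W $ i $ j * complex_of_real (f (d j)) = complex_of_real (f (e i)) * W $ i $ j" for i j
    using comm[of i j] by (cases "W $ i $ j = 0") (auto simp: mult.commute)
  then have W: "W ** diag_real (\<lambda>i. f (d i)) = diag_real (\<lambda>i. f (e i)) ** W"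
    by (simp add: vec_eq_iff entry_r entry_l)
  have VW: "V ** W = U" and WU: "W ** adjoint_mat U = adjoint_mat V"
    using U V(1) unfolding W_def unitary_mat_def
    by (metis matrix_mul_assoc matrix_mul_lid, metis matrix_mul_assoc matrix_mul_rid)
  have "U ** diag_real (\<lambda>i. f (d i)) ** adjoint_mat U
      = V ** (W ** diag_real (\<lambda>i. f (d i))) ** adjoint_mat U"
    by (simp add: VW matrix_mul_assoc)
  also have "\<dots> = V ** diag_real (\<lambda>i. f (e i)) ** (W ** adjoint_mat U)"
    by (simp add: W matrix_mul_assoc)
  finally show "B = U ** diag_real (\<lambda>i. f (d i)) ** adjoint_mat U"
    by (simp add: B WU)
qed

lemma charpoly_degree_monic:
  fixes A :: "complex^'n^'n"
  shows "degree (charpoly A) = CARD('n)" and "lead_coeff (charpoly A) = 1"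
proof -
  let ?M = "(\<chi> i j. (if i = j then [:0, 1:] else 0) - [:A $ i $ j:]) :: complex poly^'n^'n"
  let ?t = "\<lambda>p. of_int (sign p) * (\<Prod>i\<in>UNIV. ?M $ i $ p i)"
  have entry: "?M $ i $ j = (if i = j then [:- A $ i $ j, 1:] else [:- A $ i $ j:])" for i j
    by simp
  have off: "degree (?t p) < CARD('n)" if "p \<noteq> id" for p
  proof -
    from that obtain a where a: "p a \<noteq> a" by (metis eq_id_iff)
    have "degree (?t p) \<le> degree (\<Prod>i\<in>UNIV. ?M $ i $ p i)"
      using degree_mult_le[of "of_int (sign p) :: complex poly" "\<Prod>i\<in>UNIV. ?M $ i $ p i"] by simp
    also have "\<dots> \<le> (\<Sum>i\<in>UNIV. degree (?M $ i $ p i))"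
      using degree_prod_sum_le[of UNIV "\<lambda>i. ?M $ i $ p i"] by (simp add: o_def)
    also have "\<dots> < (\<Sum>i\<in>(UNIV::'n set). 1)"
      by (rule sum_strict_mono_ex1) (use a in \<open>auto intro!: exI[of _ a] simp: entry\<close>)
    finally show ?thesis by simp
  qed
  define P where "P = (\<Prod>i\<in>(UNIV::'n set). [:- A $ i $ i, 1:])"
  define R where "R = (\<Sum>p\<in>{p. p permutes (UNIV::'n set)} - {id}. ?t p)"
  have P: "degree P = CARD('n)" "lead_coeff P = 1"
    unfolding P_def by (subst degree_prod_eq_sum_degree, simp, simp) (simp add: lead_coeff_prod)
  have "charpoly A = (\<Sum>p\<in>{p. p permutes (UNIV::'n set)}. ?t p)"
    by (simp add: charpoly_def det_def)
  also have "\<dots> = ?t id + R"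
    unfolding R_def by (rule sum.remove) (auto simp: finite_permutations permutes_id)
  also have "?t id = P" by (simp add: P_def sign_id)
  finally have eq: "charpoly A = P + R" .
  have R: "degree R < CARD('n)"
  proof (cases "CARD('n)")
    case (Suc c)
    then have "degree R \<le> c"
      unfolding R_def using off by (intro degree_sum_le) (auto simp: finite_permutations less_Suc_eq_le)
    then show ?thesis using Suc by simp
  qed simp
  show deg: "degree (charpoly A) = CARD('n)"
    using P R by (simp add: eq degree_add_eq_left)
  show "lead_coeff (charpoly A) = 1"
    using P R by (simp add: eq degree_add_eq_left coeff_eq_0)
qed

lemma charpoly_eigenvalues:
  fixes A :: "complex^'n^'n"
  shows "charpoly A = (\<Prod>i\<in>UNIV. [:- eigenvalues A i, 1:])"
proof -
  have "charpoly A \<noteq> 0" using charpoly_degree_monic(2)[of A] by auto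
  from alg_closed_imp_factorization[OF this] obtain M
    where M: "size M = CARD('n)" "charpoly A = (\<Prod>x\<in>#M. [:-x, 1:])"
    by (metis charpoly_degree_monic smult_1_left)
  obtain xs where xs: "mset xs = M" using ex_mset by blast
  obtain h where h: "bij_betw h (UNIV::'n set) {..<CARD('n)}"
    by (metis atLeast0LessThan ex_bij_betw_finite_nat finite)
  have len: "length xs = CARD('n)" using M(1) xs by auto
  have "charpoly A = prod_list (map (\<lambda>x. [:-x, 1:]) xs)"
    using M(2) xs by (metis mset_map prod_mset_prod_list)
  also have "\<dots> = (\<Prod>i<CARD('n). [:- (xs ! i), 1:])"
    by (simp add: prod.list_conv_set_nth len atLeast0LessThan)
  also have "\<dots> = (\<Prod>i\<in>UNIV. [:- (xs ! h i), 1:])"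
    by (rule prod.reindex_bij_betw[OF h, symmetric])
  finally have "\<exists>e :: 'n \<Rightarrow> complex. charpoly A = (\<Prod>i\<in>UNIV. [:- e i, 1:])"
    by (intro exI[where x="\<lambda>i. xs ! h i"])
  then show ?thesis unfolding eigenvalues_def by (rule someI_ex)
qed

end

theory Submission
  imports Defs
begin

text \<open>Write \<open>L(A) = H + \<Sum>\<^sub>j p\<^sub>j log A\<^sub>j\<close>, and let \<open>g\<close> be the \<open>k\<close>-th root of the elementary symmetric polynomial
  \<open>e\<^sub>k\<close>. For fixed positive definite \<open>Y\<close> the map \<open>A \<mapsto> Tr exp (L(A) + log Y)\<close> is concave by Lieb's theorem, and
  \<open>\<phi>(exp L)\<close> is the minimum of \<open>Tr exp (L + log Y)\<close> over those \<open>Y\<close> whose eigenvalues \<open>w\<close> satisfy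
  \<open>g(y) \<le> \<langle>w, y\<rangle>\<close> for all positive \<open>y\<close>; a minimum of concave functions is concave. The minimum is attained at
  the \<open>Y\<close> commuting with \<open>L\<close> whose eigenvalues are the gradient of \<open>g\<close>, by concavity and homogeneity of \<open>g\<close>.
  That no admissible \<open>Y\<close> gives less reduces to commuting \<open>L\<close> and \<open>Y\<close>, because a minimiser of the trace on
  the unitary orbit of \<open>Y\<close> commutes with \<open>L\<close>.

  Lieb's theorem follows from Gibbs' variational principle and the joint concavity of
  \<open>Tr X (log A - log X)\<close>. The concavity of \<open>g\<close> follows from the superadditivity of the ratios \<open>e\<^sub>k\<^sub>+\<^sub>1 / e\<^sub>k\<close>
  (Marcus and Lopes), which are averages of parallel sums of the same ratios of lower order.\<close>

subsection \<open>Hermitian and unitary matrices\<close>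

lemma adjoint_nth [simp]: "adjoint_mat A $ i $ j = cnj (A $ j $ i)"
  by (simp add: adjoint_mat_def)

lemma adjoint_adjoint [simp]: "adjoint_mat (adjoint_mat A) = A"
  by (simp add: vec_eq_iff)

lemma adjoint_mult: "adjoint_mat (A ** B) = adjoint_mat B ** adjoint_mat A"
  by (simp add: vec_eq_iff matrix_matrix_mult_def mult.commute)

lemma adjoint_add: "adjoint_mat (A + B) = adjoint_mat A + adjoint_mat B"
  by (simp add: vec_eq_iff)

lemma adjoint_diff: "adjoint_mat (A - B) = adjoint_mat A - adjoint_mat B"
  by (simp add: vec_eq_iff)

lemma adjoint_scaleR: "adjoint_mat (c *\<^sub>R A) = c *\<^sub>R adjoint_mat A"
  by (simp add: vec_eq_iff)

lemma adjoint_sum: "adjoint_mat (\<Sum>i\<in>I. A i) = (\<Sum>i\<in>I. adjoint_mat (A i))"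
  by (simp add: vec_eq_iff)

lemma adjoint_diag_real [simp]: "adjoint_mat (diag_real d) = diag_real d"
  by (simp add: vec_eq_iff diag_real_def)

lemma adjoint_mat_1 [simp]: "adjoint_mat (mat 1) = mat 1"
  by (simp add: vec_eq_iff mat_def)

lemma HermD: "A \<in> Herm \<Longrightarrow> adjoint_mat A = A"
  by (simp add: Herm_def)

lemma Herm_nth: "A \<in> Herm \<Longrightarrow> cnj (A $ i $ j) = A $ j $ i"
  by (metis HermD adjoint_nth)

lemma Herm_add: "A \<in> Herm \<Longrightarrow> B \<in> Herm \<Longrightarrow> A + B \<in> Herm"
  by (simp add: Herm_def adjoint_add)

lemma Herm_diff: "A \<in> Herm \<Longrightarrow> B \<in> Herm \<Longrightarrow> A - B \<in> Herm"
  by (simp add: Herm_def adjoint_diff)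

lemma Herm_scaleR: "A \<in> Herm \<Longrightarrow> c *\<^sub>R A \<in> Herm"
  by (simp add: Herm_def adjoint_scaleR)

lemma Herm_sum: "(\<And>i. i \<in> I \<Longrightarrow> A i \<in> Herm) \<Longrightarrow> (\<Sum>i\<in>I. A i) \<in> Herm"
  by (simp add: Herm_def adjoint_sum)

lemma unitaryD:
  assumes "unitary_mat U"
  shows "adjoint_mat U ** U = mat 1" "U ** adjoint_mat U = mat 1"
  using assms by (auto simp: unitary_mat_def)

lemma unitary_cancel:
  assumes "unitary_mat U"
  shows "adjoint_mat U ** (U ** A) = A" "U ** (adjoint_mat U ** A) = A"
    and "B ** adjoint_mat U ** U = B" "B ** U ** adjoint_mat U = B"
  using assms by (simp_all add: matrix_mul_assoc unitaryD flip: matrix_mul_assoc[of B])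

lemma unitary_adjoint: "unitary_mat U \<Longrightarrow> unitary_mat (adjoint_mat U)"
  by (simp add: unitary_mat_def)

lemma unitary_mult: "unitary_mat U \<Longrightarrow> unitary_mat V \<Longrightarrow> unitary_mat (U ** V)"
  by (simp add: unitary_mat_def adjoint_mult matrix_mul_assoc)
     (simp add: unitary_mat_def unitary_cancel flip: matrix_mul_assoc)

lemma unitary_1: "unitary_mat (mat 1)"
  by (simp add: unitary_mat_def)

lemma unitary_row_norm:
  assumes "unitary_mat W"
  shows "(\<Sum>j\<in>UNIV. (cmod (W $ i $ j))\<^sup>2) = 1"
proof -
  have "complex_of_real (\<Sum>j\<in>UNIV. (cmod (W $ i $ j))\<^sup>2) = (W ** adjoint_mat W) $ i $ i"
    by (simp add: matrix_matrix_mult_def flip: complex_norm_square)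
  also have "\<dots> = 1"
    using unitaryD(2)[OF assms] by (simp add: mat_def)
  finally show ?thesis by (metis of_real_eq_1_iff)
qed

lemma unitary_col_norm:
  assumes "unitary_mat W"
  shows "(\<Sum>i\<in>UNIV. (cmod (W $ i $ j))\<^sup>2) = 1"
  using unitary_row_norm[OF unitary_adjoint[OF assms], of j] by simp

lemma diag_real_mult_nth [simp]: "(diag_real d ** A) $ i $ j = of_real (d i) * A $ i $ j"
  by (simp add: matrix_matrix_mult_def diag_real_def if_distrib[of "\<lambda>x. x * y" for y] cong: if_cong)

lemma mult_diag_real_nth [simp]: "(A ** diag_real d) $ i $ j = A $ i $ j * of_real (d j)"
  by (simp add: matrix_matrix_mult_def diag_real_def if_distrib cong: if_cong)

lemma Herm_conj: "A \<in> Herm \<Longrightarrow> U ** A ** adjoint_mat U \<in> Herm"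
  by (simp add: Herm_def adjoint_mult matrix_mul_assoc)

lemma Herm_diag_real: "diag_real d \<in> Herm"
  by (simp add: Herm_def)

section \<open>Quadratic forms and the cone of positive definite matrices\<close>

lemma inner_matrix_adjoint:
  fixes A :: "complex^'n^'n"
  shows "inner x (A *v y) = inner (adjoint_mat A *v x) y"
proof -
  have *: "inner a (b * c) = inner (cnj b * a) c" for a b c :: complex
    by (simp add: inner_complex_def algebra_simps)
  have "inner x (A *v y) = (\<Sum>i\<in>UNIV. \<Sum>j\<in>UNIV. inner (x $ i) (A $ i $ j * y $ j))"
    by (simp add: inner_vec_def matrix_vector_mult_def inner_sum_right)
  also have "\<dots> = (\<Sum>j\<in>UNIV. \<Sum>i\<in>UNIV. inner (cnj (A $ i $ j) * x $ i) (y $ j))"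
    by (subst sum.swap) (simp add: *)
  also have "\<dots> = inner (adjoint_mat A *v x) y"
    by (simp add: inner_vec_def matrix_vector_mult_def inner_sum_left)
  finally show ?thesis .
qed

lemma matrix_vector_scaleR:
  fixes A :: "complex^'n^'m"
  shows "A *v (c *\<^sub>R x) = c *\<^sub>R (A *v x)" "(c *\<^sub>R A) *v x = c *\<^sub>R (A *v x)"
  by (simp_all add: vec_eq_iff matrix_vector_mult_def scaleR_sum_right)

text \<open>The real \<open>inner\<close> of \<open>complex^'n\<close> is the real part of the
  Hermitian form, so definiteness and Rayleigh quotients can be handled in the underlying real
  Euclidean space.\<close>

lemma quadratic_form_eq_inner:
  fixes A :: "complex^'n^'n"
  shows "Re (\<Sum>i\<in>UNIV. cnj (x $ i) * (A *v x) $ i) = inner x (A *v x)"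
  by (simp add: inner_vec_def inner_complex_def)

lemma HPD_iff: "A \<in> HPD \<longleftrightarrow> A \<in> Herm \<and> (\<forall>x. x \<noteq> 0 \<longrightarrow> 0 < inner x (A *v x))"
  unfolding HPD_def quadratic_form_eq_inner by simp

lemma HPD_Herm: "A \<in> HPD \<Longrightarrow> A \<in> Herm"
  by (simp add: HPD_iff)

lemma convex_HPD: "convex HPD"
proof (rule convexI)
  fix A B :: "complex^'n^'n" and u v :: real
  assume AB: "A \<in> HPD" "B \<in> HPD" and uv: "0 \<le> u" "0 \<le> v" "u + v = 1"
  have pos: "0 < u * a + v * b" if "0 < a" "0 < b" for a b
    using uv that by (cases "u = 0") (auto simp: add_pos_nonneg)
  show "u *\<^sub>R A + v *\<^sub>R B \<in> HPD"
    using AB by (auto simp: HPD_iff Herm_add Herm_scaleR matrix_vector_mult_add_rdistrib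
        inner_right_distrib pos matrix_vector_scaleR)
qed

subsection \<open>Spectral theorem for commuting Hermitian matrices\<close>

text \<open>Rayleigh's argument: let \<open>x\<close> maximise the quadratic form on the unit sphere
  of \<open>V\<close>, with value \<open>a\<close>. Then \<open>q\<close> is nonnegative on
  \<open>V\<close> and vanishes at \<open>x\<close>. Moving \<open>x\<close> along the residual
  \<open>z\<close>, which lies in \<open>V\<close> by invariance, would make \<open>q\<close>
  negative unless \<open>z = 0\<close>.\<close>

lemma selfadjoint_eigenvector_in_subspace:
  fixes A :: "complex^'n^'n"
  assumes A: "A \<in> Herm" and V: "subspace V" "V \<noteq> {0}" and inv: "\<And>x. x \<in> V \<Longrightarrow> A *v x \<in> V"
  obtains x a where "x \<in> V" "x \<noteq> 0" "A *v x = a *\<^sub>R x"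
proof -
  define S where "S = V \<inter> sphere 0 1"
  have "compact S"
    unfolding S_def using closed_subspace[OF V(1)] by (simp add: closed_Int_compact)
  moreover have "S \<noteq> {}"
  proof -
    obtain v where v: "v \<in> V" "v \<noteq> 0" using V subspace_0 by blast
    then have "(1 / norm v) *\<^sub>R v \<in> S" unfolding S_def using V(1) by (simp add: subspace_scale)
    then show ?thesis by blast
  qed
  moreover have "continuous_on S (\<lambda>x. inner x (A *v x))"
    by (intro continuous_intros linear_continuous_on linear_linear[THEN iffD2] matrix_vector_mul_linear)
  ultimately obtain x where x: "x \<in> S" and max: "\<And>y. y \<in> S \<Longrightarrow> inner y (A *v y) \<le> inner x (A *v x)"
    using continuous_attains_sup[of S "\<lambda>x. inner x (A *v x)"] by blast
  define a where "a = inner x (A *v x)"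
  define q where "q y = a * inner y y - inner y (A *v y)" for y
  have xV: "x \<in> V" and nx: "norm x = 1" using x by (auto simp: S_def)
  have q_nonneg: "q y \<ge> 0" if "y \<in> V" for y
  proof (cases "y = 0")
    case False
    have "(1 / norm y) *\<^sub>R y \<in> S" unfolding S_def using V(1) that False by (simp add: subspace_scale)
    from max[OF this] have "inner y (A *v y) / (norm y)\<^sup>2 \<le> a"
      by (simp add: a_def matrix_vector_scaleR power2_eq_square)
    then show ?thesis using False by (simp add: q_def field_simps flip: power2_norm_eq_inner)
  qed (simp add: q_def)
  have sym: "inner y (A *v z) = inner (A *v y) z" for y z
    by (simp add: inner_matrix_adjoint HermD[OF A])
  define z where "z = a *\<^sub>R x - A *v x"
  have zV: "z \<in> V" unfolding z_def using V(1) xV inv by (simp add: subspace_diff subspace_scale)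
  have expand: "q (x + t *\<^sub>R z) = 2 * t * inner z z + t\<^sup>2 * q z" for t
  proof -
    have e1: "inner z (A *v x) = inner x (A *v z)"
      using sym[of x z] by (simp add: inner_commute)
    have e2: "q x = 0" using nx by (simp add: q_def a_def flip: power2_norm_eq_inner)
    have "q (x + t *\<^sub>R z) = q x + 2 * t * inner (a *\<^sub>R x - A *v x) z + t\<^sup>2 * q z"
      unfolding q_def
      by (simp add: matrix_vector_right_distrib matrix_vector_scaleR inner_add_left inner_add_right
          inner_diff_left e1 power2_eq_square algebra_simps inner_commute[of "A *v x" z] inner_commute[of z x])
    then show ?thesis using e2 by (simp add: z_def)
  qed
  have "inner z z = 0"
  proof (rule ccontr)
    assume ne: "inner z z \<noteq> 0"
    define r where "r = inner z z"
    have r: "r > 0" using ne unfolding r_def by simp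
    \<comment> \<open>A small negative \<open>t\<close> lets the linear term
      \<open>2 * t * r\<close> win over \<open>t\<^sup>2 * q z\<close>; the added \<open>r\<close>
      in the denominator also covers \<open>q z = 0\<close>.\<close>
    define t where "t = - r / (q z + r)"
    have qz: "q z \<ge> 0" using q_nonneg zV by blast
    have "0 \<le> 2 * t * r + t\<^sup>2 * q z"
      using q_nonneg[of "x + t *\<^sub>R z"] expand[of t] xV zV V(1)
      by (simp add: r_def subspace_add subspace_scale)
    also have "\<dots> = t * (2 * r + t * q z)" by (simp add: power2_eq_square algebra_simps)
    also have "\<dots> < 0"
    proof (rule mult_neg_pos)
      show "t < 0" using r qz by (simp add: t_def)
      have "- t * q z < 2 * r" using r qz unfolding t_def
        by (simp add: field_simps) (smt (verit) mult_nonneg_nonneg mult_pos_pos)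
      then show "0 < 2 * r + t * q z" by simp
    qed
    finally show False by simp
  qed
  then have "A *v x = a *\<^sub>R x" by (simp add: z_def)
  then show ?thesis using that xV nx by force
qed

text \<open>Commutation makes the eigenspace of \<open>A\<close> inside \<open>V\<close> invariant
  under \<open>B\<close>, so the Rayleigh argument applies to \<open>B\<close> on that
  eigenspace.\<close>

lemma common_eigenvector_in_subspace:
  fixes A B :: "complex^'n^'n"
  assumes A: "A \<in> Herm" and B: "B \<in> Herm" and AB: "A ** B = B ** A"
    and V: "subspace V" "V \<noteq> {0}"
    and inv: "\<And>x. x \<in> V \<Longrightarrow> A *v x \<in> V" "\<And>x. x \<in> V \<Longrightarrow> B *v x \<in> V"
  obtains x a b where "x \<in> V" "x \<noteq> 0" "A *v x = a *\<^sub>R x" "B *v x = b *\<^sub>R x"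
proof -
  obtain y a where y: "y \<in> V" "y \<noteq> 0" "A *v y = a *\<^sub>R y"
    using selfadjoint_eigenvector_in_subspace[OF A V inv(1)] by blast
  define E where "E = V \<inter> {x. A *v x = a *\<^sub>R x}"
  have "subspace {x. A *v x = a *\<^sub>R x}"
    by (simp add: subspace_def matrix_vector_right_distrib matrix_vector_scaleR scaleR_add_right)
  then have "subspace E" unfolding E_def using V(1) by (simp add: subspace_inter)
  moreover have "E \<noteq> {0}" using y by (auto simp: E_def)
  moreover have "B *v x \<in> E" if "x \<in> E" for x
  proof -
    have "A *v (B *v x) = B *v (A *v x)" by (simp add: matrix_vector_mul_assoc AB)
    then show ?thesis using that inv(2) by (simp add: E_def matrix_vector_scaleR)
  qed
  ultimately obtain x b where "x \<in> E" "x \<noteq> 0" "B *v x = b *\<^sub>R x"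
    using selfadjoint_eigenvector_in_subspace[OF B] by blast
  then show ?thesis using that by (auto simp: E_def)
qed

text \<open>Conjugate-linear in the first argument. Unitarity is orthonormality over the complex
  numbers, and \<open>inner\<close> only sees the real part of this form.\<close>

definition cinner :: "complex^'n \<Rightarrow> complex^'n \<Rightarrow> complex"
  where "cinner x y = (\<Sum>i\<in>UNIV. cnj (x $ i) * y $ i)"

lemma Re_cinner: "Re (cinner x y) = inner x y"
  by (simp add: cinner_def inner_vec_def inner_complex_def)

lemma cinner_self: "cinner x x = complex_of_real (inner x x)"
  by (simp add: complex_eq_iff Re_cinner) (simp add: cinner_def)

lemma cinner_commute: "cinner y x = cnj (cinner x y)"
  by (simp add: cinner_def mult.commute)

lemma cinner_add: "cinner x (y + z) = cinner x y + cinner x z"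
  by (simp add: cinner_def distrib_left sum.distrib)

lemma cinner_diff: "cinner x (y - z) = cinner x y - cinner x z"
  by (simp add: cinner_def right_diff_distrib sum_subtractf)

lemma cinner_scaleR: "cinner x (c *\<^sub>R y) = c *\<^sub>R cinner x y" "cinner (c *\<^sub>R x) y = c *\<^sub>R cinner x y"
  by (simp_all add: cinner_def scaleR_sum_right)

lemma cinner_smult: "cinner x (c *s y) = c * cinner x y"
  by (simp add: cinner_def sum_distrib_left mult_ac)

lemma cinner_sum: "cinner x (\<Sum>i\<in>I. f i) = (\<Sum>i\<in>I. cinner x (f i))"
  by (simp add: cinner_def sum_distrib_left) (rule sum.swap)

lemma cinner_Herm:
  assumes "A \<in> Herm"
  shows "cinner x (A *v y) = cinner (A *v x) y"
proof -
  have "cinner x (A *v y) = (\<Sum>i\<in>UNIV. \<Sum>j\<in>UNIV. cnj (x $ i) * (A $ i $ j * y $ j))"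
    by (simp add: cinner_def matrix_vector_mult_def sum_distrib_left)
  also have "\<dots> = (\<Sum>j\<in>UNIV. \<Sum>i\<in>UNIV. cnj (A $ j $ i * x $ i) * y $ j)"
    by (subst sum.swap) (simp add: Herm_nth[OF assms] mult_ac)
  also have "\<dots> = cinner (A *v x) y"
    by (simp add: cinner_def matrix_vector_mult_def sum_distrib_right)
  finally show ?thesis .
qed

definition common_eigensystem :: "complex^'n^'n \<Rightarrow> complex^'n^'n \<Rightarrow> (complex^'n) set \<Rightarrow> bool"
  where "common_eigensystem A B S \<longleftrightarrow>
    (\<forall>x\<in>S. \<forall>y\<in>S. cinner x y = (if x = y then 1 else 0)) \<and>
    (\<forall>x\<in>S. (\<exists>a::real. A *v x = a *\<^sub>R x) \<and> (\<exists>b::real. B *v x = b *\<^sub>R x))"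

text \<open>Orthonormality over the complex numbers implies orthogonality, hence independence, over
  the reals. The real dimension is twice the sharp bound, but it suffices for a system of maximal
  cardinality to exist.\<close>

lemma common_eigensystem_bound:
  assumes "common_eigensystem A B (S :: (complex^'n) set)"
  shows "finite S" "card S \<le> DIM(complex^'n)"
proof -
  have "pairwise orthogonal S"
    unfolding pairwise_def orthogonal_def
    using assms by (auto simp: common_eigensystem_def simp flip: Re_cinner)
  moreover have "0 \<notin> S"
  proof -
    have "cinner 0 (0 :: complex^'n) = 0" by (simp add: cinner_def)
    then show ?thesis using assms unfolding common_eigensystem_def by (metis zero_neq_one)
  qed
  ultimately have "independent S" by (rule pairwise_orthogonal_independent)
  from independent_bound[OF this] show "finite S" "card S \<le> DIM(complex^'n)" by auto
qed

text \<open>Take a common eigensystem \<open>S\<close> of maximal size. Its orthogonal complement is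
  invariant under both matrices because they are Hermitian, so if nonzero it would contain a common
  eigenvector extending \<open>S\<close>. Hence \<open>S\<close> is an orthonormal basis, and it
  supplies the columns of \<open>U\<close>.\<close>

theorem simultaneous_spectral_theorem:
  fixes A B :: "complex^'n^'n"
  assumes A: "A \<in> Herm" and B: "B \<in> Herm" and AB: "A ** B = B ** A"
  obtains U a b where "unitary_mat U" "A = U ** diag_real a ** adjoint_mat U"
    "B = U ** diag_real b ** adjoint_mat U"
proof -
  let ?P = "common_eigensystem A B"
  have "\<exists>S. ?P S \<and> (\<forall>T. ?P T \<longrightarrow> card T \<le> card S)"
  proof (rule ex_has_greatest_nat)
    show "?P {}" by (simp add: common_eigensystem_def)
    show "\<forall>T. ?P T \<longrightarrow> card T < Suc (DIM(complex^'n))"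
      using common_eigensystem_bound less_Suc_eq_le by blast
  qed
  then obtain S where S: "?P S" and S_max: "\<And>T. ?P T \<Longrightarrow> card T \<le> card S" by blast
  have fin: "finite S" using common_eigensystem_bound S by blast
  have on: "cinner x y = (if x = y then 1 else 0)" if "x \<in> S" "y \<in> S" for x y
    using S that by (auto simp: common_eigensystem_def)
  define V where "V = {v. \<forall>x\<in>S. cinner x v = 0}"
  have subV: "subspace V"
    by (auto simp: V_def subspace_def cinner_add cinner_scaleR) (simp add: cinner_def)
  have inv: "M *v v \<in> V" if M: "M \<in> Herm" "\<And>x. x \<in> S \<Longrightarrow> \<exists>a::real. M *v x = a *\<^sub>R x" and v: "v \<in> V" for M v
    unfolding V_def
  proof safe
    fix x assume x: "x \<in> S"
    then obtain a where a: "M *v x = (a::real) *\<^sub>R x" using M by blast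
    show "cinner x (M *v v) = 0"
      using v x by (simp add: cinner_Herm[OF M(1)] a cinner_scaleR V_def)
  qed
  have V0: "V = {0}"
  proof (rule ccontr)
    assume "V \<noteq> {0}"
    from common_eigenvector_in_subspace[OF A B AB subV this]
    obtain x a b where x: "x \<in> V" "x \<noteq> 0" "A *v x = a *\<^sub>R x" "B *v x = b *\<^sub>R x"
      using inv A B S unfolding common_eigensystem_def by metis
    define y where "y = (1 / norm x) *\<^sub>R x"
    have yV: "y \<in> V" unfolding y_def using x(1) subV by (simp add: subspace_scale)
    have y1: "cinner y y = 1" using x(2) by (simp add: cinner_self y_def dot_square_norm power2_eq_square)
    have y0: "cinner z y = 0" "cinner y z = 0" if "z \<in> S" for z
      using yV that by (auto simp: V_def cinner_commute[of y z])
    have "A *v y = a *\<^sub>R y" "B *v y = b *\<^sub>R y"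
      by (simp_all add: y_def matrix_vector_scaleR x)
    then have "?P (insert y S)"
      using S y1 y0 unfolding common_eigensystem_def by (auto split: if_splits)
    moreover have "y \<notin> S" using y0 y1 by force
    ultimately show False using S_max[of "insert y S"] fin by simp
  qed
  have complete: "v = (\<Sum>x\<in>S. cinner x v *s x)" for v
  proof -
    have "cinner y (v - (\<Sum>x\<in>S. cinner x v *s x)) = 0" if "y \<in> S" for y
    proof -
      have "(\<Sum>x\<in>S. cinner x v * cinner y x) = (\<Sum>x\<in>S. if x = y then cinner x v else 0)"
        by (rule sum.cong) (auto simp: on that)
      then show ?thesis using fin that by (simp add: cinner_diff cinner_sum cinner_smult)
    qed
    then have "v - (\<Sum>x\<in>S. cinner x v *s x) \<in> V" by (simp add: V_def)
    then show ?thesis using V0 by simp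
  qed
  \<comment> \<open>Double counting of the squared moduli of all coordinates: each coordinate
    contributes 1 by expanding a standard basis vector, and each member of \<open>S\<close>
    contributes 1 by normalisation.\<close>
  have card: "card S = CARD('n)"
  proof -
    have row: "(\<Sum>x\<in>S. cnj (x $ i) * x $ i) = 1" for i
    proof -
      have "cinner x (axis i 1) = cnj (x $ i)" for x
        by (simp add: cinner_def axis_def if_distrib cong: if_cong)
      then show ?thesis using arg_cong[OF complete[of "axis i 1"], of "\<lambda>v. v $ i"]
        by (simp add: sum_component)
    qed
    have "of_nat CARD('n) = (\<Sum>i\<in>(UNIV::'n set). \<Sum>x\<in>S. cnj (x $ i) * x $ i)" by (simp add: row)
    also have "\<dots> = (\<Sum>x\<in>S. cinner x x)" unfolding cinner_def by (rule sum.swap)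
    also have "\<dots> = of_nat (card S)" by (simp add: on)
    finally show ?thesis using of_nat_eq_iff[where 'a=complex] by metis
  qed
  then obtain h where h: "bij_betw h (UNIV::'n set) S"
    using finite_same_card_bij[OF finite fin card[symmetric]] by blast
  have hS: "h j \<in> S" for j using h by (auto simp: bij_betw_def)
  have h_eq: "h i = h j \<longleftrightarrow> i = j" for i j using h by (auto simp: bij_betw_def inj_on_def)
  define U where "U = (\<chi> i j. h j $ i)"
  have "(adjoint_mat U ** U) $ i $ j = cinner (h i) (h j)" for i j
    by (simp add: U_def matrix_matrix_mult_def cinner_def)
  then have "(adjoint_mat U ** U) $ i $ j = (if i = j then 1 else 0)" for i j
    by (simp only: on[OF hS hS] h_eq)
  then have UU: "adjoint_mat U ** U = mat 1"
    by (simp add: vec_eq_iff mat_def)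
  then have U: "unitary_mat U" using matrix_left_right_inverse by (auto simp: unitary_mat_def)
  have diag: "\<exists>d. M = U ** diag_real d ** adjoint_mat U" if "\<And>x. x \<in> S \<Longrightarrow> \<exists>a::real. M *v x = a *\<^sub>R x" for M
  proof -
    have "\<forall>j. \<exists>a::real. M *v h j = a *\<^sub>R h j" using that hS by blast
    then obtain d where d: "\<And>j. M *v h j = (d j :: real) *\<^sub>R h j" using choice[of "\<lambda>j a. M *v h j = a *\<^sub>R h j"] by blast
    have "(M ** U) $ i $ j = (M *v h j) $ i" for i j
      by (simp add: U_def matrix_matrix_mult_def matrix_vector_mult_def)
    then have "(M ** U) $ i $ j = (U ** diag_real d) $ i $ j" for i j
      by (simp add: d U_def) (simp add: scaleR_conv_of_real)
    then have "M ** U = U ** diag_real d" by (simp add: vec_eq_iff)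
    then have "M ** U ** adjoint_mat U = U ** diag_real d ** adjoint_mat U" by simp
    then show ?thesis using U by (auto simp: unitary_cancel)
  qed
  obtain a b where "A = U ** diag_real a ** adjoint_mat U" "B = U ** diag_real b ** adjoint_mat U"
    using diag S unfolding common_eigensystem_def by metis
  then show ?thesis using U that by blast
qed

corollary spectral_theorem:
  assumes "A \<in> Herm"
  obtains U a where "unitary_mat U" "A = U ** diag_real a ** adjoint_mat U"
  using simultaneous_spectral_theorem[OF assms assms refl] by metis

subsection \<open>Functional calculus and traces\<close>

lemma herm_fun_Herm:
  assumes "A \<in> Herm"
  shows "herm_fun f A \<in> Herm"
proof -
  obtain U a where "unitary_mat U" "A = U ** diag_real a ** adjoint_mat U"
    using spectral_theorem[OF assms] .
  then show ?thesis by (simp add: herm_fun_diag Herm_conj Herm_diag_real)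
qed

lemma diag_real_one: "diag_real (\<lambda>_. 1) = mat 1"
  by (simp add: vec_eq_iff diag_real_def mat_def)

text \<open>In the coordinates \<open>adjoint_mat U *v x\<close> the quadratic form is a sum of
  squared moduli with weights \<open>a i\<close>; the columns of \<open>U\<close> isolate the single
  weights.\<close>

lemma HPD_conj_diag_iff:
  fixes U :: "complex^'n^'n"
  assumes U: "unitary_mat U"
  shows "U ** diag_real a ** adjoint_mat U \<in> HPD \<longleftrightarrow> (\<forall>i. a i > 0)"
proof -
  let ?A = "U ** diag_real a ** adjoint_mat U"
  have form: "inner x (?A *v x) = (\<Sum>i\<in>UNIV. a i * (cmod ((adjoint_mat U *v x) $ i))\<^sup>2)" for x
  proof -
    define y where "y = adjoint_mat U *v x"
    have "inner x (?A *v x) = inner x (U *v (diag_real a *v y))"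
      by (simp add: y_def matrix_vector_mul_assoc matrix_mul_assoc)
    also have "\<dots> = inner y (diag_real a *v y)"
      by (simp add: inner_matrix_adjoint y_def)
    also have "\<dots> = (\<Sum>i\<in>UNIV. inner (y $ i) (of_real (a i) * y $ i))"
      by (simp add: inner_vec_def matrix_vector_mult_def diag_real_def
          if_distrib[of "\<lambda>x. x * y" for y] cong: if_cong)
    also have "\<dots> = (\<Sum>i\<in>UNIV. a i * (cmod (y $ i))\<^sup>2)"
      by (rule sum.cong, rule refl, simp add: inner_complex_def cmod_power2)
        (simp add: power2_eq_square algebra_simps)
    finally show ?thesis by (simp add: y_def)
  qed
  have H: "?A \<in> Herm" by (simp add: Herm_conj Herm_diag_real)
  show ?thesis
  proof
    assume pd: "?A \<in> HPD"
    show "\<forall>i. a i > 0"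
    proof
      fix i
      define x :: "complex^'n" where "x = U *v axis i 1"
      have y: "adjoint_mat U *v x = axis i 1"
        by (simp add: x_def matrix_vector_mul_assoc unitaryD[OF U])
      then have "x \<noteq> 0" by (auto simp: axis_eq_0_iff)
      then have "0 < inner x (?A *v x)" using pd by (simp add: HPD_iff)
      also have "\<dots> = a i" unfolding form y
        by (simp add: axis_def if_distrib[of "\<lambda>x. cmod x ^ 2"] if_distrib[of "\<lambda>x. z * x" for z] cong: if_cong)
      finally show "a i > 0" .
    qed
  next
    assume pos: "\<forall>i. a i > 0"
    show "?A \<in> HPD" unfolding HPD_iff
    proof (intro conjI allI impI H)
      fix x :: "complex^'n" assume "x \<noteq> 0"
      define y where "y = adjoint_mat U *v x"
      have "U *v y = x" by (simp add: y_def matrix_vector_mul_assoc unitaryD[OF U])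
      then have "y \<noteq> 0" using \<open>x \<noteq> 0\<close> by auto
      then obtain i where "y $ i \<noteq> 0" by (auto simp: vec_eq_iff)
      then show "0 < inner x (?A *v x)"
        unfolding form y_def[symmetric] using pos
        by (intro sum_pos2[of UNIV i]) (auto simp: less_imp_le)
    qed
  qed
qed

lemma HPD_spectral:
  assumes "A \<in> HPD"
  obtains U a where "unitary_mat U" "A = U ** diag_real a ** adjoint_mat U" "\<And>i. a i > 0"
  using spectral_theorem[OF HPD_Herm[OF assms]] HPD_conj_diag_iff assms by metis

lemma herm_exp_HPD:
  assumes "A \<in> Herm"
  shows "herm_exp A \<in> HPD"
proof -
  obtain U a where "unitary_mat U" "A = U ** diag_real a ** adjoint_mat U"
    using spectral_theorem[OF assms] .
  then show ?thesis by (simp add: herm_fun_diag HPD_conj_diag_iff)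
qed

lemma herm_log_exp:
  assumes "A \<in> Herm"
  shows "herm_log (herm_exp A) = A"
proof -
  obtain U a where U: "unitary_mat U" and A: "A = U ** diag_real a ** adjoint_mat U"
    using spectral_theorem[OF assms] .
  have "herm_log (herm_exp A) = U ** diag_real (\<lambda>i. ln (exp (a i))) ** adjoint_mat U"
    by (rule herm_fun_diag[OF U]) (rule herm_fun_diag[OF U A])
  then show ?thesis by (simp add: A)
qed

section \<open>Traces in spectral coordinates and Gibbs' principle\<close>

lemma matrix_add_rdistrib: "(A + B) ** C = A ** C + B ** C"
  by (simp add: vec_eq_iff matrix_matrix_mult_def distrib_right sum.distrib)

lemma matrix_diff_distrib:
  fixes A B C :: "complex^'n^'n"
  shows "(A - B) ** C = A ** C - B ** C" "C ** (A - B) = C ** A - C ** B"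
  by (simp_all add: vec_eq_iff matrix_matrix_mult_def left_diff_distrib right_diff_distrib sum_subtractf)

lemma trace_scaleR: "trace (c *\<^sub>R A) = c *\<^sub>R trace (A :: complex^'n^'n)"
  by (simp add: trace_def scaleR_sum_right)

lemma trace_conj_diag:
  assumes "unitary_mat U"
  shows "trace (U ** diag_real a ** adjoint_mat U) = of_real (\<Sum>i\<in>UNIV. a i)"
proof -
  have "trace (U ** diag_real a ** adjoint_mat U) = trace (adjoint_mat U ** (U ** diag_real a))"
    by (rule trace_mul_sym)
  also have "\<dots> = of_real (\<Sum>i\<in>UNIV. a i)"
    by (simp add: unitary_cancel[OF assms]) (simp add: trace_def diag_real_def)
  finally show ?thesis .
qed

lemma trace_diag_mult_diag:
  "trace (diag_real a ** W ** diag_real x ** adjoint_mat W) =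
    of_real (\<Sum>i\<in>UNIV. \<Sum>j\<in>UNIV. (cmod (W $ i $ j))\<^sup>2 * (a i * x j))"
proof -
  have "trace (diag_real a ** W ** diag_real x ** adjoint_mat W) =
      (\<Sum>i\<in>UNIV. \<Sum>j\<in>UNIV. of_real (a i) * (W $ i $ j * of_real (x j)) * cnj (W $ i $ j))"
    by (simp add: trace_def matrix_matrix_mult_def[of _ "adjoint_mat W"]) (simp add: mult_ac flip: matrix_mul_assoc)
  also have "\<dots> = of_real (\<Sum>i\<in>UNIV. \<Sum>j\<in>UNIV. (cmod (W $ i $ j))\<^sup>2 * (a i * x j))"
    unfolding of_real_sum of_real_mult complex_norm_square by (simp add: mult_ac)
  finally show ?thesis .
qed

lemma trace_mult_spectral:
  assumes A: "A = U ** diag_real a ** adjoint_mat U" and X: "X = V ** diag_real x ** adjoint_mat V"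
  shows "trace (X ** A) =
    of_real (\<Sum>i\<in>UNIV. \<Sum>j\<in>UNIV. (cmod ((adjoint_mat U ** V) $ i $ j))\<^sup>2 * (a i * x j))"
proof -
  have "trace (X ** A) = trace (A ** X)" by (rule trace_mul_sym)
  also have "\<dots> = trace (U ** (diag_real a ** (adjoint_mat U ** V) ** diag_real x ** adjoint_mat V))"
    by (simp add: A X matrix_mul_assoc)
  also have "\<dots> = trace (diag_real a ** (adjoint_mat U ** V) ** diag_real x ** adjoint_mat (adjoint_mat U ** V))"
    by (subst trace_mul_sym) (simp add: adjoint_mult matrix_mul_assoc)
  also have "\<dots> = of_real (\<Sum>i\<in>UNIV. \<Sum>j\<in>UNIV. (cmod ((adjoint_mat U ** V) $ i $ j))\<^sup>2 * (a i * x j))"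
    by (rule trace_diag_mult_diag)
  finally show ?thesis .
qed

text \<open>The squared moduli of a unitary matrix form a doubly stochastic matrix. Traces involving
  only one of two matrices can thus be spread over the same double sum as the mixed traces of
  \<open>trace_mult_spectral\<close>, and trace inequalities reduce to scalar inequalities for each
  pair of eigenvalues.\<close>

lemma unitary_weights_sum:
  fixes W :: "complex^'n^'n"
  assumes "unitary_mat W"
  shows "(\<Sum>i\<in>UNIV. \<Sum>j\<in>UNIV. (cmod (W $ i $ j))\<^sup>2 * f i) = (\<Sum>i\<in>UNIV. f i)"
    and "(\<Sum>i\<in>UNIV. \<Sum>j\<in>UNIV. (cmod (W $ i $ j))\<^sup>2 * g j) = (\<Sum>j\<in>UNIV. (g j :: real))"
  by (simp add: unitary_row_norm[OF assms] flip: sum_distrib_right)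
     (subst sum.swap, simp add: unitary_col_norm[OF assms] flip: sum_distrib_right)

lemma trace_mult_herm_fun_self:
  assumes V: "unitary_mat V" and X: "X = V ** diag_real x ** adjoint_mat V"
  shows "trace (X ** herm_fun f X) = of_real (\<Sum>j\<in>UNIV. x j * f (x j))"
proof -
  have "diag_real x ** diag_real (\<lambda>j. f (x j)) = diag_real (\<lambda>j. x j * f (x j))"
    by (simp add: vec_eq_iff) (simp add: diag_real_def)
  moreover have "X ** herm_fun f X = V ** (diag_real x ** diag_real (\<lambda>j. f (x j))) ** adjoint_mat V"
    unfolding herm_fun_diag[OF V X] by (subst X) (simp add: unitary_cancel[OF V] matrix_mul_assoc)
  ultimately show ?thesis by (simp add: trace_conj_diag[OF V])
qed

text \<open>Entrywise in the two eigenbases this is the tangent line bound for \<open>exp\<close> at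
  0, applied to \<open>m i - ln (x j)\<close> and scaled by \<open>x j\<close>. Equality holds at
  \<open>X = herm_exp M\<close>, so the trace exponential is a maximum over
  \<open>X\<close>.\<close>

lemma gibbs_variational_inequality:
  assumes M: "M \<in> Herm" and X: "X \<in> HPD"
  shows "Re (trace (X ** M)) - Re (trace (X ** herm_log X)) + Re (trace X) \<le> Re (trace (herm_exp M))"
proof -
  obtain U m where U: "unitary_mat U" "M = U ** diag_real m ** adjoint_mat U"
    using spectral_theorem[OF M] by metis
  obtain V x where V: "unitary_mat V" "X = V ** diag_real x ** adjoint_mat V" "\<And>i. x i > 0"
    using HPD_spectral[OF X] by metis
  define W where "W = adjoint_mat U ** V"
  have W: "unitary_mat W" by (simp add: W_def unitary_mult unitary_adjoint U V)
  let ?s = "\<lambda>f. \<Sum>i\<in>UNIV. \<Sum>j\<in>UNIV. (cmod (W $ i $ j))\<^sup>2 * f i j"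
  have "Re (trace (X ** M)) = ?s (\<lambda>i j. m i * x j)"
    by (simp add: trace_mult_spectral[OF U(2) V(2)] W_def)
  moreover have "Re (trace (herm_exp M)) = ?s (\<lambda>i j. exp (m i))"
    by (simp add: herm_fun_diag[OF U] trace_conj_diag[OF U(1)] unitary_weights_sum[OF W])
  moreover have "Re (trace X) = ?s (\<lambda>i j. x j)"
    by (simp add: V(2) trace_conj_diag V unitary_weights_sum[OF W])
  moreover have "Re (trace (X ** herm_log X)) = ?s (\<lambda>i j. x j * ln (x j))"
    by (simp add: trace_mult_herm_fun_self[OF V(1,2)] unitary_weights_sum[OF W])
  moreover have "?s (\<lambda>i j. m i * x j) - ?s (\<lambda>i j. x j * ln (x j)) + ?s (\<lambda>i j. x j) \<le> ?s (\<lambda>i j. exp (m i))"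
    unfolding sum_subtractf[symmetric] sum.distrib[symmetric]
  proof (intro sum_mono)
    fix i j
    have "x j * (1 + (m i - ln (x j))) \<le> x j * exp (m i - ln (x j))"
      by (intro mult_left_mono exp_ge_add_one_self less_imp_le V)
    also have "\<dots> = exp (m i)" using V(3)[of j] by (simp add: exp_diff)
    finally have "m i * x j - x j * ln (x j) + x j \<le> exp (m i)" by (simp add: algebra_simps)
    from mult_left_mono[OF this, of "(cmod (W $ i $ j))\<^sup>2"]
    show "(cmod (W $ i $ j))\<^sup>2 * (m i * x j) - (cmod (W $ i $ j))\<^sup>2 * (x j * ln (x j)) + (cmod (W $ i $ j))\<^sup>2 * x j
        \<le> (cmod (W $ i $ j))\<^sup>2 * exp (m i)"
      by (simp add: algebra_simps)
  qed
  ultimately show ?thesis by simp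
qed

subsection \<open>Joint concavity of the negative relative entropy\<close>

text \<open>In eigenbases of \<open>A\<close> and \<open>X\<close> with overlap matrix \<open>W\<close>, the minimum of the form below over \<open>Z\<close> is
  \<open>- \<Sum> \<bar>W\<^sub>i\<^sub>j\<bar>\<^sup>2 x\<^sub>j\<^sup>2 / (a\<^sub>i + t x\<^sub>j)\<close>, and \<open>x / (1 + t) - x\<^sup>2 / (a + t x)\<close> integrates over \<open>t \<ge> 0\<close> to \<open>x (ln a - ln x)\<close>.
  The form is affine in \<open>(X, A)\<close>, so its minimum is jointly concave.\<close>

definition relent_form :: "real \<Rightarrow> complex^'n^'n \<Rightarrow> complex^'n^'n \<Rightarrow> complex^'n^'n \<Rightarrow> real"
  where "relent_form t X A Z = Re (trace (adjoint_mat Z ** A ** Z)) + t * Re (trace (Z ** X ** adjoint_mat Z))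
    - 2 * Re (trace (Z ** X))"

lemma relent_form_affine:
  "relent_form t (u *\<^sub>R X + v *\<^sub>R Y) (u *\<^sub>R A + v *\<^sub>R B) Z = u * relent_form t X A Z + v * relent_form t Y B Z"
  by (simp add: relent_form_def matrix_add_ldistrib matrix_add_rdistrib matrix_scalar_ac trace_add
      trace_scaleR algebra_simps flip: scalar_matrix_assoc)

context
  fixes U V A X :: "complex^'n^'n" and a x :: "'n \<Rightarrow> real" and t :: real
  assumes U: "unitary_mat U" and A: "A = U ** diag_real a ** adjoint_mat U" and a: "\<And>i. a i > 0"
    and V: "unitary_mat V" and X: "X = V ** diag_real x ** adjoint_mat V" and x: "\<And>i. x i > 0"
    and t: "t \<ge> 0"
begin

text \<open>Written in the two eigenbases, the form decouples into one scalar quadratic for each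
  entry of \<open>z\<close>, and these can be minimised separately.\<close>

lemma relent_form_spectral:
  "relent_form t X A (U ** z ** adjoint_mat V) = (\<Sum>i\<in>UNIV. \<Sum>j\<in>UNIV.
     (a i + t * x j) * (cmod (z $ i $ j))\<^sup>2 - 2 * x j * Re (z $ i $ j * cnj ((adjoint_mat U ** V) $ i $ j)))"
proof -
  let ?Z = "U ** z ** adjoint_mat V" and ?W = "adjoint_mat U ** V"
  have "trace (adjoint_mat ?Z ** A ** ?Z) = trace (A ** (?Z ** adjoint_mat ?Z))"
    by (subst matrix_mul_assoc[symmetric], subst trace_mul_sym) (simp add: matrix_mul_assoc)
  also have "A ** (?Z ** adjoint_mat ?Z) = U ** (diag_real a ** z ** adjoint_mat z ** adjoint_mat U)"
    by (simp add: A adjoint_mult matrix_mul_assoc unitary_cancel U V)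
  also have "trace \<dots> = trace (diag_real a ** z ** diag_real (\<lambda>_. 1) ** adjoint_mat z)"
    by (simp add: trace_mul_sym[of U] unitary_cancel U diag_real_one)
  finally have 1: "Re (trace (adjoint_mat ?Z ** A ** ?Z)) = (\<Sum>i\<in>UNIV. \<Sum>j\<in>UNIV. (cmod (z $ i $ j))\<^sup>2 * a i)"
    by (simp add: trace_diag_mult_diag)
  have "?Z ** X ** adjoint_mat ?Z = U ** (z ** diag_real x ** adjoint_mat z ** adjoint_mat U)"
    by (simp add: X adjoint_mult matrix_mul_assoc unitary_cancel U V)
  also have "trace \<dots> = trace (diag_real (\<lambda>_. 1) ** z ** diag_real x ** adjoint_mat z)"
    by (simp add: trace_mul_sym[of U] unitary_cancel U diag_real_one)
  finally have 2: "Re (trace (?Z ** X ** adjoint_mat ?Z)) = (\<Sum>i\<in>UNIV. \<Sum>j\<in>UNIV. (cmod (z $ i $ j))\<^sup>2 * x j)"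
    by (simp add: trace_diag_mult_diag)
  have "?Z ** X = U ** (z ** diag_real x ** adjoint_mat V)"
    by (simp add: X matrix_mul_assoc unitary_cancel V)
  then have "trace (?Z ** X) = trace (z ** diag_real x ** adjoint_mat ?W)"
    by (metis trace_mul_sym adjoint_mult adjoint_adjoint matrix_mul_assoc)
  also have "\<dots> = (\<Sum>i\<in>UNIV. \<Sum>j\<in>UNIV. (z $ i $ j * of_real (x j)) * cnj (?W $ i $ j))"
    by (simp add: trace_def matrix_matrix_mult_def[of _ "adjoint_mat ?W"])
  finally have 3: "Re (trace (?Z ** X)) = (\<Sum>i\<in>UNIV. \<Sum>j\<in>UNIV. x j * Re (z $ i $ j * cnj (?W $ i $ j)))"
    by (simp add: algebra_simps)
  show ?thesis
    unfolding relent_form_def 1 2 3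
    by (simp add: sum_distrib_left sum_subtractf sum.distrib distrib_right mult_ac)
qed

text \<open>Complete the square in each scalar quadratic; in the auxiliary bound \<open>b\<close>
  stands for \<open>a i + t * x j\<close> and \<open>w\<close> for the overlap entry.\<close>

lemma relent_form_lower:
  "- (\<Sum>i\<in>UNIV. \<Sum>j\<in>UNIV. (cmod ((adjoint_mat U ** V) $ i $ j))\<^sup>2 * ((x j)\<^sup>2 / (a i + t * x j))) \<le> relent_form t X A Z"
proof -
  define z where "z = adjoint_mat U ** Z ** V"
  have Z: "Z = U ** z ** adjoint_mat V"
    by (simp add: z_def unitary_cancel U V matrix_mul_assoc unitaryD)
  have *: "- ((cmod w)\<^sup>2 * (y\<^sup>2 / b)) \<le> b * (cmod u)\<^sup>2 - 2 * y * Re (u * cnj w)" if "b > 0" for u w :: complex and b y :: real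
  proof -
    have "0 \<le> (cmod (of_real b * u - of_real y * w))\<^sup>2" by simp
    also have "\<dots> = b\<^sup>2 * (cmod u)\<^sup>2 - 2 * b * y * Re (u * cnj w) + y\<^sup>2 * (cmod w)\<^sup>2"
      by (simp only: cmod_power2) (simp add: power2_eq_square algebra_simps)
    finally have "0 \<le> (b\<^sup>2 * (cmod u)\<^sup>2 - 2 * b * y * Re (u * cnj w) + y\<^sup>2 * (cmod w)\<^sup>2) / b"
      using that by simp
    also have "\<dots> = b * (cmod u)\<^sup>2 - 2 * y * Re (u * cnj w) + (cmod w)\<^sup>2 * (y\<^sup>2 / b)"
      using that by (simp add: divide_simps power2_eq_square del: times_complex.sel) (simp add: algebra_simps)
    finally show ?thesis by simp
  qed
  show ?thesis
    unfolding Z relent_form_spectral sum_negf[symmetric]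
    by (intro sum_mono *) (use a x t in \<open>auto intro: add_pos_nonneg simp: less_imp_le\<close>)
qed

lemma relent_form_attained:
  "\<exists>Z. relent_form t X A Z =
    - (\<Sum>i\<in>UNIV. \<Sum>j\<in>UNIV. (cmod ((adjoint_mat U ** V) $ i $ j))\<^sup>2 * ((x j)\<^sup>2 / (a i + t * x j)))"
proof
  \<comment> \<open>The entrywise minimiser, at which every completed square of
    \<open>relent_form_lower\<close> vanishes.\<close>
  define z where "z = (\<chi> i j. of_real (x j / (a i + t * x j)) * (adjoint_mat U ** V) $ i $ j)"
  have *: "b * (cmod (of_real (y / b) * w))\<^sup>2 - 2 * y * Re (of_real (y / b) * w * cnj w) = - ((cmod w)\<^sup>2 * (y\<^sup>2 / b))"
    if "b > 0" for w :: complex and b y :: real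
  proof -
    have "Re (of_real (y / b) * w * cnj w) = y / b * (cmod w)\<^sup>2"
      unfolding mult.assoc complex_norm_square[symmetric] of_real_mult[symmetric] Re_complex_of_real ..
    then show ?thesis using that
      by (simp only: norm_mult norm_of_real power_mult_distrib) (simp add: divide_simps power2_eq_square)
  qed
  have pos: "a i + t * x j > 0" for i j
    using a x t by (auto intro: add_pos_nonneg simp: less_imp_le)
  show "relent_form t X A (U ** z ** adjoint_mat V) =
    - (\<Sum>i\<in>UNIV. \<Sum>j\<in>UNIV. (cmod ((adjoint_mat U ** V) $ i $ j))\<^sup>2 * ((x j)\<^sup>2 / (a i + t * x j)))"
    unfolding relent_form_spectral sum_negf[symmetric]
  proof (intro sum.cong refl)
    fix i j
    have z: "z $ i $ j = of_real (x j / (a i + t * x j)) * (adjoint_mat U ** V) $ i $ j"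
      by (simp add: z_def)
    show "(a i + t * x j) * (cmod (z $ i $ j))\<^sup>2 - 2 * x j * Re (z $ i $ j * cnj ((adjoint_mat U ** V) $ i $ j)) =
       - ((cmod ((adjoint_mat U ** V) $ i $ j))\<^sup>2 * ((x j)\<^sup>2 / (a i + t * x j)))"
      unfolding z by (rule *[OF pos])
  qed
qed

end

section \<open>Integral representation of the relative entropy\<close>

lemma relent_form_attained_HPD:
  assumes "X \<in> HPD" "A \<in> HPD" "0 \<le> t"
  obtains Z where "\<And>Y. relent_form t X A Z \<le> relent_form t X A Y"
proof -
  obtain U a where U: "unitary_mat U" "A = U ** diag_real a ** adjoint_mat U" "\<And>i. a i > 0"
    using HPD_spectral[OF assms(2)] by metis
  obtain V x where V: "unitary_mat V" "X = V ** diag_real x ** adjoint_mat V" "\<And>i. x i > 0"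
    using HPD_spectral[OF assms(1)] by metis
  show ?thesis
    using relent_form_attained[OF U V assms(3)] relent_form_lower[OF U V assms(3)] that by metis
qed

text \<open>The first term cancels the leading behaviour of the minimum for large \<open>t\<close>,
  which is minus the trace of \<open>X\<close> divided by \<open>t\<close>, so that the integral
  over all \<open>t \<ge> 0\<close> converges.\<close>

definition relent_integrand :: "real \<Rightarrow> complex^'n^'n \<Rightarrow> complex^'n^'n \<Rightarrow> real"
  where "relent_integrand t X A = Re (trace X) / (1 + t) + (INF Z. relent_form t X A Z)"

text \<open>The minimiser \<open>Z\<close> for the convex combination competes at both endpoints,
  and for fixed \<open>Z\<close> the form is affine in \<open>(X, A)\<close>.\<close>

lemma relent_integrand_concave:
  assumes HPD: "X \<in> HPD" "Y \<in> HPD" "A \<in> HPD" "B \<in> HPD"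
    and t: "0 \<le> t" and uv: "0 \<le> u" "0 \<le> v" "u + v = 1"
  shows "u * relent_integrand t X A + v * relent_integrand t Y B
    \<le> relent_integrand t (u *\<^sub>R X + v *\<^sub>R Y) (u *\<^sub>R A + v *\<^sub>R B)"
proof -
  let ?f = relent_form
  have "u *\<^sub>R X + v *\<^sub>R Y \<in> HPD" "u *\<^sub>R A + v *\<^sub>R B \<in> HPD"
    using convexD[OF convex_HPD] HPD uv by blast+
  then obtain Z where Z: "\<And>W. ?f t (u *\<^sub>R X + v *\<^sub>R Y) (u *\<^sub>R A + v *\<^sub>R B) Z \<le> ?f t (u *\<^sub>R X + v *\<^sub>R Y) (u *\<^sub>R A + v *\<^sub>R B) W"
    using relent_form_attained_HPD t by metis
  have low: "(INF W. ?f t X' A' W) \<le> ?f t X' A' Z" if X': "X' \<in> HPD" "A' \<in> HPD" for X' A'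
  proof (rule cINF_lower)
    obtain W where "\<And>W'. ?f t X' A' W \<le> ?f t X' A' W'"
      using relent_form_attained_HPD[OF X' t] by metis
    then show "bdd_below (range (?f t X' A'))" by (intro bdd_belowI2[where m = "?f t X' A' W"])
  qed simp
  have "u * (INF W. ?f t X A W) + v * (INF W. ?f t Y B W) \<le> u * ?f t X A Z + v * ?f t Y B Z"
    using low HPD uv by (intro add_mono mult_left_mono) auto
  also have "\<dots> = ?f t (u *\<^sub>R X + v *\<^sub>R Y) (u *\<^sub>R A + v *\<^sub>R B) Z"
    by (simp add: relent_form_affine)
  also have "\<dots> \<le> (INF W. ?f t (u *\<^sub>R X + v *\<^sub>R Y) (u *\<^sub>R A + v *\<^sub>R B) W)"
    using Z by (intro cINF_greatest) auto
  finally show ?thesis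
    unfolding relent_integrand_def by (simp add: trace_add trace_scaleR algebra_simps add_divide_distrib)
qed

text \<open>The negative of Umegaki's quantum relative entropy of \<open>X\<close> with respect to
  \<open>A\<close>.\<close>

definition neg_relent :: "complex^'n^'n \<Rightarrow> complex^'n^'n \<Rightarrow> real"
  where "neg_relent X A = Re (trace (X ** herm_log A)) - Re (trace (X ** herm_log X))"

lemma relent_integrand_integral:
  assumes X: "X \<in> HPD" and A: "A \<in> HPD"
  shows "T \<ge> 0 \<Longrightarrow> (\<lambda>t. relent_integrand t X A) integrable_on {0..T}"
    and "((\<lambda>T. integral {0..T} (\<lambda>t. relent_integrand t X A)) \<longlongrightarrow> neg_relent X A) at_top"
proof -
  obtain U a where U: "unitary_mat U" "A = U ** diag_real a ** adjoint_mat U" "\<And>i. a i > 0"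
    using HPD_spectral[OF A] by metis
  obtain V x where V: "unitary_mat V" "X = V ** diag_real x ** adjoint_mat V" "\<And>i. x i > 0"
    using HPD_spectral[OF X] by metis
  define W where "W = adjoint_mat U ** V"
  have W: "unitary_mat W" by (simp add: W_def unitary_mult unitary_adjoint U V)
  let ?s = "\<lambda>f. \<Sum>i\<in>UNIV. \<Sum>j\<in>UNIV. (cmod (W $ i $ j))\<^sup>2 * f i j"
  have trX: "Re (trace X) = ?s (\<lambda>i j. x j)"
    by (simp add: V(2) trace_conj_diag V unitary_weights_sum[OF W])
  have integrand: "relent_integrand t X A = ?s (\<lambda>i j. x j / (1 + t) - (x j)\<^sup>2 / (a i + t * x j))" if t: "t \<ge> 0" for t
  proof -
    obtain Z where Z: "relent_form t X A Z = - ?s (\<lambda>i j. (x j)\<^sup>2 / (a i + t * x j))"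
      using relent_form_attained[OF U V t] unfolding W_def by blast
    have "(INF Z. relent_form t X A Z) = - ?s (\<lambda>i j. (x j)\<^sup>2 / (a i + t * x j))"
      unfolding Z[symmetric]
    proof (rule cInf_eq_minimum)
      show "relent_form t X A Z \<le> y" if "y \<in> range (relent_form t X A)" for y
        using that relent_form_lower[OF U V t] unfolding Z W_def by blast
    qed simp
    then show ?thesis
      unfolding relent_integrand_def trX
      by (simp add: right_diff_distrib sum_subtractf sum_divide_distrib)
  qed
  \<comment> \<open>An antiderivative in \<open>T\<close> of the scalar integrand; the summand
    \<open>ln (a i)\<close> makes it vanish at \<open>T = 0\<close>.\<close>
  define F where "F i j T = x j * (ln (1 + T) - ln (a i + T * x j) + ln (a i))" for i j T
  have pos: "a i + t * x j > 0" if "t \<ge> 0" for i j t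
    using U(3) V(3) that by (auto intro: add_pos_nonneg simp: less_imp_le)
  have int: "((\<lambda>t. relent_integrand t X A) has_integral ?s (\<lambda>i j. F i j T)) {0..T}" if T: "T \<ge> 0" for T
  proof -
    have "((\<lambda>t. x j / (1 + t) - (x j)\<^sup>2 / (a i + t * x j)) has_integral F i j T - F i j 0) {0..T}" for i j
    proof (rule fundamental_theorem_of_calculus[OF T])
      fix t assume t: "t \<in> {0..T}"
      have "(F i j has_real_derivative x j / (1 + t) - (x j)\<^sup>2 / (a i + t * x j)) (at t)"
        unfolding F_def using t pos[of t i j]
        by (auto intro!: derivative_eq_intros simp: field_simps power2_eq_square)
      then show "(F i j has_vector_derivative x j / (1 + t) - (x j)\<^sup>2 / (a i + t * x j)) (at t within {0..T})"
        using has_real_derivative_iff_has_vector_derivative has_vector_derivative_at_within by blast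
    qed
    then have "((\<lambda>t. ?s (\<lambda>i j. x j / (1 + t) - (x j)\<^sup>2 / (a i + t * x j))) has_integral ?s (\<lambda>i j. F i j T)) {0..T}"
      by (intro has_integral_sum has_integral_mult_right) (auto simp: F_def)
    then show ?thesis
      by (rule has_integral_eq[rotated]) (simp add: integrand)
  qed
  show "T \<ge> 0 \<Longrightarrow> (\<lambda>t. relent_integrand t X A) integrable_on {0..T}" using int by blast
  have "(F i j \<longlongrightarrow> x j * (ln (a i) - ln (x j))) at_top" for i j
  proof -
    \<comment> \<open>The two diverging logarithms combine into that of
      \<open>(a i + T * x j) / (1 + T)\<close>, which is \<open>x j\<close> plus a vanishing
      term.\<close>
    have "((\<lambda>T. (a i - x j) / (1 + T)) \<longlongrightarrow> 0) at_top"
      by (intro tendsto_divide_0[OF tendsto_const] filterlim_at_top_imp_at_infinity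
          filterlim_tendsto_add_at_top[OF tendsto_const filterlim_ident])
    then have lim: "((\<lambda>T. x j + (a i - x j) / (1 + T)) \<longlongrightarrow> x j + 0) at_top"
      by (intro tendsto_add tendsto_const)
    have "((\<lambda>T. x j * (ln (a i) - ln (x j + (a i - x j) / (1 + T)))) \<longlongrightarrow> x j * (ln (a i) - ln (x j + 0))) at_top"
      using V(3)[of j] by (intro tendsto_mult tendsto_diff tendsto_const tendsto_ln lim) simp
    then have "(F i j \<longlongrightarrow> x j * (ln (a i) - ln (x j + 0))) at_top"
    proof (rule Lim_transform_eventually)
      show "\<forall>\<^sub>F T in at_top. x j * (ln (a i) - ln (x j + (a i - x j) / (1 + T))) = F i j T"
        using eventually_ge_at_top[of 0]
      proof eventually_elim
        case (elim T)
        have "x j + (a i - x j) / (1 + T) = (a i + T * x j) / (1 + T)" using elim by (simp add: field_simps)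
        then show ?case using pos[OF elim, of i j] elim by (simp add: F_def ln_div)
      qed
    qed
    then show ?thesis by simp
  qed
  then have lim: "((\<lambda>T. ?s (\<lambda>i j. F i j T)) \<longlongrightarrow> ?s (\<lambda>i j. x j * (ln (a i) - ln (x j)))) at_top"
    by (intro tendsto_intros)
  have spectral: "?s (\<lambda>i j. x j * (ln (a i) - ln (x j))) = neg_relent X A"
  proof -
    have "Re (trace (X ** herm_log A)) = ?s (\<lambda>i j. ln (a i) * x j)"
      by (simp add: trace_mult_spectral[OF herm_fun_diag[OF U(1,2)] V(2)] W_def)
    moreover have "Re (trace (X ** herm_log X)) = ?s (\<lambda>i j. x j * ln (x j))"
      by (simp add: trace_mult_herm_fun_self[OF V(1,2)] unitary_weights_sum[OF W])
    ultimately show ?thesis unfolding neg_relent_def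
      by (simp add: algebra_simps sum_subtractf)
  qed
  have "\<forall>\<^sub>F T in at_top. ?s (\<lambda>i j. F i j T) = integral {0..T} (\<lambda>t. relent_integrand t X A)"
    using eventually_ge_at_top[of 0] by eventually_elim (rule integral_unique[OF int, symmetric])
  from Lim_transform_eventually[OF lim this]
  show "((\<lambda>T. integral {0..T} (\<lambda>t. relent_integrand t X A)) \<longlongrightarrow> neg_relent X A) at_top"
    unfolding spectral .
qed

text \<open>The pointwise inequality of \<open>relent_integrand_concave\<close> is integrated over
  \<open>{0..T}\<close> and survives the limit as \<open>T\<close> tends to infinity.\<close>

theorem neg_relent_jointly_concave:
  assumes HPD: "X \<in> HPD" "Y \<in> HPD" "A \<in> HPD" "B \<in> HPD"
    and uv: "0 \<le> u" "0 \<le> v" "u + v = 1"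
  shows "u * neg_relent X A + v * neg_relent Y B \<le> neg_relent (u *\<^sub>R X + v *\<^sub>R Y) (u *\<^sub>R A + v *\<^sub>R B)"
proof -
  let ?I = "\<lambda>X A T. integral {0..T} (\<lambda>t. relent_integrand t X A)"
  let ?X = "u *\<^sub>R X + v *\<^sub>R Y" and ?A = "u *\<^sub>R A + v *\<^sub>R B"
  have comb: "?X \<in> HPD" "?A \<in> HPD"
    using convexD[OF convex_HPD] HPD uv by blast+
  have "\<forall>\<^sub>F T in at_top. u * ?I X A T + v * ?I Y B T \<le> ?I ?X ?A T"
    using eventually_ge_at_top[of 0]
  proof eventually_elim
    case (elim T)
    note int = relent_integrand_integral(1)[OF HPD(1,3) elim] relent_integrand_integral(1)[OF HPD(2,4) elim]
      relent_integrand_integral(1)[OF comb elim]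
    note mult = integrable_on_mult_right[OF int(1), of u] integrable_on_mult_right[OF int(2), of v]
    have "u * ?I X A T + v * ?I Y B T = integral {0..T} (\<lambda>t. u * relent_integrand t X A + v * relent_integrand t Y B)"
      by (simp add: integral_add[OF mult])
    also have "\<dots> \<le> ?I ?X ?A T"
      by (intro integral_le relent_integrand_concave HPD uv integrable_add[OF mult] int(3)) simp
    finally show ?case .
  qed
  then show ?thesis
    by (intro tendsto_le[OF _ relent_integrand_integral(2)[OF comb]])
      (auto intro!: tendsto_intros relent_integrand_integral(2) HPD)
qed

subsection \<open>Lieb's concavity theorem\<close>

lemma matrix_mult_sum_right: "A ** (\<Sum>i\<in>I. B i) = (\<Sum>i\<in>I. A ** B i)"
  by (simp add: vec_eq_iff matrix_matrix_mult_def sum_distrib_left) (auto intro: sum.swap)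

lemma trace_sum: "trace (\<Sum>i\<in>I. A i) = (\<Sum>i\<in>I. trace (A i))"
  by (simp add: trace_def) (rule sum.swap)

lemma mat_1_HPD: "(mat 1 :: complex^'n^'n) \<in> HPD"
  using HPD_conj_diag_iff[OF unitary_1, of "\<lambda>_. 1"] by (simp add: diag_real_one)

lemma diag_real_zero: "diag_real (\<lambda>_. 0) = 0"
  by (simp add: diag_real_def vec_eq_iff)

lemma herm_log_1: "herm_log (mat 1) = 0"
  using herm_fun_diag[OF unitary_1, of "mat 1" "\<lambda>_. 1" ln]
  by (simp add: diag_real_one diag_real_zero)

text \<open>By Gibbs' principle the trace exponential is the maximum over \<open>X\<close> of the
  functional \<open>G\<close>, which is jointly concave in \<open>X\<close> and the matrices
  \<open>A j\<close>; maximising out one argument preserves concavity.\<close>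

theorem lieb_concavity:
  fixes A B :: "'m::finite \<Rightarrow> complex^'n^'n" and p :: "'m \<Rightarrow> real"
  assumes H: "H \<in> Herm" and p: "\<And>j. 0 \<le> p j" "(\<Sum>j\<in>UNIV. p j) \<le> 1"
    and AB: "\<And>j. A j \<in> HPD" "\<And>j. B j \<in> HPD" and uv: "0 \<le> u" "0 \<le> v" "u + v = 1"
  shows "u * Re (trace (herm_exp (H + (\<Sum>j\<in>UNIV. p j *\<^sub>R herm_log (A j)))))
      + v * Re (trace (herm_exp (H + (\<Sum>j\<in>UNIV. p j *\<^sub>R herm_log (B j)))))
    \<le> Re (trace (herm_exp (H + (\<Sum>j\<in>UNIV. p j *\<^sub>R herm_log (u *\<^sub>R A j + v *\<^sub>R B j)))))"
proof -
  define L where "L A = H + (\<Sum>j\<in>UNIV. p j *\<^sub>R herm_log (A j))" for A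
  \<comment> \<open>The entropy term of Gibbs' functional has weight 1. It is divided into the
    shares \<open>p j\<close>, which complete relative entropies against \<open>A j\<close>, and the
    rest, which is paired with \<open>mat 1\<close> because its logarithm is 0. All weights are
    nonnegative by the assumptions on \<open>p\<close>.\<close>
  define G where "G X A = Re (trace (X ** H)) + Re (trace X) + (\<Sum>j\<in>UNIV. p j * neg_relent X (A j))
    + (1 - (\<Sum>j\<in>UNIV. p j)) * neg_relent X (mat 1)" for X A
  define C where "C j = u *\<^sub>R A j + v *\<^sub>R B j" for j
  have C: "C j \<in> HPD" for j
    unfolding C_def using convexD[OF convex_HPD] AB uv by blast
  have L: "L A \<in> Herm" if "\<And>j. A j \<in> HPD" for A
    unfolding L_def by (intro Herm_add H Herm_sum Herm_scaleR herm_fun_Herm HPD_Herm that)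
  have G_eq: "G X A = Re (trace (X ** L A)) - Re (trace (X ** herm_log X)) + Re (trace X)" for X A
    by (simp add: G_def L_def neg_relent_def herm_log_1 matrix_add_ldistrib matrix_mult_sum_right matrix_scalar_ac
        trace_add trace_sum trace_scaleR algebra_simps sum_subtractf sum_distrib_left sum_distrib_right
        flip: scalar_matrix_assoc) (simp add: trace_def)
  have G_le: "G X A \<le> Re (trace (herm_exp (L A)))" if "X \<in> HPD" "\<And>j. A j \<in> HPD" for X A
    unfolding G_eq using gibbs_variational_inequality L that by blast
  have G_exp: "G (herm_exp (L A)) A = Re (trace (herm_exp (L A)))" if "\<And>j. A j \<in> HPD" for A
    unfolding G_eq using herm_log_exp[OF L[OF that]] by simp
  \<comment> \<open>\<open>X\<close> and \<open>Y\<close> maximise \<open>G\<close> at the two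
    endpoints; their mixture is only a competitor at \<open>C\<close>, which is the direction
    needed.\<close>
  define X where "X = herm_exp (L A)"
  define Y where "Y = herm_exp (L B)"
  have XY: "X \<in> HPD" "Y \<in> HPD" by (simp_all add: X_def Y_def herm_exp_HPD L AB)
  have XYc: "u *\<^sub>R X + v *\<^sub>R Y \<in> HPD" using convexD[OF convex_HPD] XY uv by blast
  have uv1: "u *\<^sub>R mat 1 + v *\<^sub>R mat 1 = (mat 1 :: complex^'n^'n)"
    using uv(3) by (simp flip: scaleR_add_left)
  have "u * Re (trace (herm_exp (L A))) + v * Re (trace (herm_exp (L B))) = u * G X A + v * G Y B"
    using G_exp AB by (simp add: X_def Y_def)
  also have "\<dots> = Re (trace ((u *\<^sub>R X + v *\<^sub>R Y) ** H)) + Re (trace (u *\<^sub>R X + v *\<^sub>R Y))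
      + (\<Sum>j\<in>UNIV. p j * (u * neg_relent X (A j) + v * neg_relent Y (B j)))
      + (1 - (\<Sum>j\<in>UNIV. p j)) * (u * neg_relent X (mat 1) + v * neg_relent Y (mat 1))"
    by (simp add: G_def matrix_add_rdistrib trace_add trace_scaleR distrib_left sum.distrib sum_distrib_left
        mult.left_commute[of u] mult.left_commute[of v] flip: scalar_matrix_assoc)
  also have "\<dots> \<le> G (u *\<^sub>R X + v *\<^sub>R Y) C"
    unfolding G_def C_def
  proof (intro add_mono order_refl sum_mono mult_left_mono)
    show "u * neg_relent X (mat 1) + v * neg_relent Y (mat 1) \<le> neg_relent (u *\<^sub>R X + v *\<^sub>R Y) (mat 1)"
      using neg_relent_jointly_concave[OF XY mat_1_HPD mat_1_HPD uv] by (simp only: uv1)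
  qed (use p neg_relent_jointly_concave[OF XY AB uv] in auto)
  also have "\<dots> \<le> Re (trace (herm_exp (L C)))" using G_le XYc C by blast
  finally show ?thesis by (simp add: L_def C_def)
qed

subsection \<open>Elementary symmetric polynomials\<close>

text \<open>Indexed by a set rather than a type, because the recursions below delete single
  variables.\<close>

definition esym :: "'a set \<Rightarrow> nat \<Rightarrow> ('a \<Rightarrow> real) \<Rightarrow> real"
  where "esym S k x = (\<Sum>I | I \<subseteq> S \<and> card I = k. \<Prod>i\<in>I. x i)"

lemma esym_0:
  assumes "finite S"
  shows "esym S 0 x = 1"
proof -
  have "{I. I \<subseteq> S \<and> card I = 0} = {{}}"
    using assms by (auto dest: finite_subset)
  then show ?thesis by (simp add: esym_def)
qed

lemma esym_empty [simp]: "esym {} (Suc k) x = 0"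
proof -
  have "{I. I \<subseteq> {} \<and> card I = Suc k} = ({} :: 'a set set)" by auto
  then show ?thesis unfolding esym_def by (metis sum.empty)
qed

lemma esym_insert:
  assumes S: "finite S" "j \<notin> S"
  shows "esym (insert j S) (Suc k) x = esym S (Suc k) x + x j * esym S k x"
proof -
  let ?P = "\<lambda>n. {I. I \<subseteq> S \<and> card I = n}"
  have fin: "finite (?P n)" for n using S(1) by auto
  have split: "{I. I \<subseteq> insert j S \<and> card I = Suc k} = ?P (Suc k) \<union> insert j ` ?P k"
  proof (intro equalityI subsetI)
    fix I assume I: "I \<in> {I. I \<subseteq> insert j S \<and> card I = Suc k}"
    show "I \<in> ?P (Suc k) \<union> insert j ` ?P k"
    proof (cases "j \<in> I")
      case True
      then have "I = insert j (I - {j})" "I - {j} \<in> ?P k" using I S by auto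
      then show ?thesis by blast
    qed (use I in auto)
  next
    fix I assume I: "I \<in> ?P (Suc k) \<union> insert j ` ?P k"
    have "card (insert j J) = Suc (card J)" if "J \<subseteq> S" for J
      using that S finite_subset by (subst card_insert_disjoint) auto
    then show "I \<in> {I. I \<subseteq> insert j S \<and> card I = Suc k}"
      using I by auto
  qed
  have inj: "inj_on (insert j) (?P k)"
    using S(2) by (auto simp: inj_on_def)
  have "esym (insert j S) (Suc k) x = esym S (Suc k) x + (\<Sum>I\<in>insert j ` ?P k. \<Prod>i\<in>I. x i)"
    unfolding esym_def split using fin S(2) by (intro sum.union_disjoint) auto
  also have "(\<Sum>I\<in>insert j ` ?P k. \<Prod>i\<in>I. x i) = (\<Sum>I\<in>?P k. x j * (\<Prod>i\<in>I. x i))"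
    unfolding sum.reindex[OF inj] o_def
  proof (rule sum.cong[OF refl])
    fix I assume "I \<in> ?P k"
    then have "finite I" "j \<notin> I" using S by (auto dest: finite_subset)
    then show "(\<Prod>i\<in>insert j I. x i) = x j * (\<Prod>i\<in>I. x i)" by simp
  qed
  finally show ?thesis by (simp add: esym_def sum_distrib_left)
qed

lemma esym_remove:
  assumes "finite S" "i \<in> S"
  shows "esym S (Suc k) x = esym (S - {i}) (Suc k) x + x i * esym (S - {i}) k x"
  using esym_insert[of "S - {i}" i k x] assms by (simp add: insert_absorb)

lemma esym_nonneg: "(\<And>i. i \<in> S \<Longrightarrow> x i \<ge> 0) \<Longrightarrow> esym S k x \<ge> 0"
  unfolding esym_def by (intro sum_nonneg prod_nonneg) auto

lemma esym_pos:
  assumes "finite S" "k \<le> card S" "\<And>i. i \<in> S \<Longrightarrow> x i > 0"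
  shows "esym S k x > 0"
proof -
  obtain I where I: "I \<subseteq> S" "card I = k" using obtain_subset_with_card_n[OF assms(2)] by metis
  show ?thesis unfolding esym_def
    by (rule sum_pos2[of _ I]) (use I assms in \<open>auto intro!: prod_pos prod_nonneg intro: less_imp_le\<close>)
qed

text \<open>The directional derivative along \<open>y\<close> of \<open>esym S (Suc k)\<close>, not
  of \<open>esym S k\<close>: the index is the degree of the partial derivatives, each of which is
  \<open>esym\<close> with one variable deleted.\<close>

definition esym_deriv :: "'a set \<Rightarrow> nat \<Rightarrow> ('a \<Rightarrow> real) \<Rightarrow> ('a \<Rightarrow> real) \<Rightarrow> real"
  where "esym_deriv S k x y = (\<Sum>i\<in>S. y i * esym (S - {i}) k x)"

lemma esym_deriv_0: "finite S \<Longrightarrow> esym_deriv S 0 x y = sum y S"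
  by (simp add: esym_deriv_def esym_0)

lemma esym_deriv_insert:
  assumes S: "finite S" "j \<notin> S"
  shows "esym_deriv (insert j S) (Suc k) x y =
    y j * esym S (Suc k) x + esym_deriv S (Suc k) x y + x j * esym_deriv S k x y"
proof -
  have "esym (insert j S - {i}) (Suc k) x = esym (S - {i}) (Suc k) x + x j * esym (S - {i}) k x" if "i \<in> S" for i
  proof -
    have "insert j S - {i} = insert j (S - {i})" using that S by auto
    then show ?thesis using S by (simp add: esym_insert)
  qed
  moreover have "insert j S - {j} = S" using S by auto
  ultimately show ?thesis
    using S by (simp add: esym_deriv_def sum_distrib_left distrib_left sum.distrib mult_ac)
qed

lemma esym_1:
  assumes "finite S"
  shows "esym S (Suc 0) x = sum x S"
  using assms by (induction S rule: finite_induct) (simp_all add: esym_insert esym_0)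

text \<open>Euler's identity for homogeneous polynomials; the factor is the degree of
  \<open>esym S (Suc k)\<close>.\<close>

lemma esym_euler:
  assumes "finite S"
  shows "esym_deriv S k x x = (real k + 1) * esym S (Suc k) x"
  using assms
proof (induction S arbitrary: k rule: finite_induct)
  case (insert j S)
  show ?case
  proof (cases k)
    case 0
    then show ?thesis using insert.hyps by (simp add: esym_deriv_0 esym_1)
  next
    case (Suc k')
    then show ?thesis using insert by (simp add: esym_deriv_insert esym_insert algebra_simps)
  qed
qed (simp add: esym_deriv_def)

lemma esym_has_derivative:
  assumes "finite S"
  shows "((\<lambda>t. esym S (Suc k) (\<lambda>i. x i + t * y i)) has_real_derivative esym_deriv S k (\<lambda>i. x i + t * y i) y) (at t)"
  using assms
proof (induction S arbitrary: k rule: finite_induct)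
  case (insert j S)
  show ?case
  proof (cases k)
    case 0
    have "((\<lambda>t. \<Sum>i\<in>insert j S. x i + t * y i) has_real_derivative (\<Sum>i\<in>insert j S. y i)) (at t)"
      by (auto intro!: derivative_eq_intros)
    then show ?thesis using insert.hyps 0 by (simp only: esym_deriv_0 esym_1 finite_insert)
  next
    case (Suc k')
    show ?thesis unfolding Suc using insert.hyps
      by (simp add: esym_deriv_insert esym_insert)
        (rule derivative_eq_intros insert.IH refl | simp)+
  qed
qed (simp add: esym_deriv_def)

section \<open>Ratios of consecutive elementary symmetric polynomials and concavity of the
  root\<close>

definition esym_ratio :: "'a set \<Rightarrow> nat \<Rightarrow> ('a \<Rightarrow> real) \<Rightarrow> real"
  where "esym_ratio S k x = esym S (Suc k) x / esym S k x"

lemma esym_ratio_nonneg: "(\<And>i. i \<in> S \<Longrightarrow> x i \<ge> 0) \<Longrightarrow> esym_ratio S k x \<ge> 0"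
  by (simp add: esym_ratio_def esym_nonneg)

lemma esym_ratio_pos:
  assumes "finite S" "k < card S" "\<And>i. i \<in> S \<Longrightarrow> x i > 0"
  shows "esym_ratio S k x > 0"
  using assms by (simp add: esym_ratio_def esym_pos)

text \<open>The product telescopes, starting from \<open>esym S 0 x = 1\<close>. This transfers
  properties of the ratios to \<open>esym\<close>.\<close>

lemma esym_eq_prod_ratio:
  assumes "finite S" "k \<le> card S" "\<And>i. i \<in> S \<Longrightarrow> x i > 0"
  shows "esym S k x = (\<Prod>j<k. esym_ratio S j x)"
  using assms(2)
proof (induction k)
  case (Suc k)
  then have "esym S k x > 0" using assms by (intro esym_pos) auto
  then have "esym S (Suc k) x = esym S k x * esym_ratio S k x" by (simp add: esym_ratio_def)
  then show ?case using Suc by simp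
qed (simp add: esym_0 assms)

text \<open>Euler's identity expresses the numerator through polynomials with one variable deleted,
  and \<open>esym_remove\<close> splits the denominator; each quotient becomes a parallel sum of
  \<open>x i\<close> and a ratio of order \<open>k\<close> in one variable fewer.\<close>

lemma esym_ratio_Suc:
  assumes S: "finite S" "Suc k \<le> card S" and x: "\<And>i. i \<in> S \<Longrightarrow> x i > 0"
  shows "(real k + 2) * esym_ratio S (Suc k) x =
    (\<Sum>i\<in>S. x i * esym_ratio (S - {i}) k x / (esym_ratio (S - {i}) k x + x i))"
proof -
  have "(real k + 2) * esym_ratio S (Suc k) x = esym_deriv S (Suc k) x x / esym S (Suc k) x"
    using esym_euler[OF S(1), of "Suc k" x] by (simp add: esym_ratio_def)
  also have "\<dots> = (\<Sum>i\<in>S. x i * (esym (S - {i}) (Suc k) x / esym S (Suc k) x))"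
    by (simp add: esym_deriv_def sum_divide_distrib)
  also have "\<dots> = (\<Sum>i\<in>S. x i * esym_ratio (S - {i}) k x / (esym_ratio (S - {i}) k x + x i))"
  proof (rule sum.cong[OF refl])
    fix i assume i: "i \<in> S"
    have "esym (S - {i}) k x > 0" using S x i by (intro esym_pos) auto
    then show "x i * (esym (S - {i}) (Suc k) x / esym S (Suc k) x) =
        x i * esym_ratio (S - {i}) k x / (esym_ratio (S - {i}) k x + x i)"
      unfolding esym_remove[OF S(1) i] esym_ratio_def by (simp add: divide_simps mult_ac)
  qed
  finally show ?thesis .
qed

text \<open>The parallel sum \<open>x r / (r + x)\<close> is the minimum over \<open>s\<close> of \<open>x s\<^sup>2 + r (1 - s)\<^sup>2\<close>, which is linear and
  increasing in \<open>(x, r)\<close>.\<close>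

lemma parallel_sum_superadditive:
  fixes x y r q R :: real
  assumes x: "x > 0" "y > 0" and r: "r \<ge> 0" "q \<ge> 0" "r + q \<le> R"
  shows "x * r / (r + x) + y * q / (q + y) \<le> (x + y) * R / (R + (x + y))"
proof -
  have min: "a * b / (b + a) \<le> a * s\<^sup>2 + b * (1 - s)\<^sup>2" if "a > 0" "b \<ge> 0" for a b s :: real
  proof -
    have "(a * s\<^sup>2 + b * (1 - s)\<^sup>2) * (b + a) - a * b = (a * s - b * (1 - s))\<^sup>2"
      by (simp add: power2_eq_square algebra_simps)
    then have "a * b \<le> (a * s\<^sup>2 + b * (1 - s)\<^sup>2) * (b + a)"
      using zero_le_power2[of "a * s - b * (1 - s)"] by linarith
    then show ?thesis using that by (simp add: pos_divide_le_eq)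
  qed
  \<comment> \<open>The minimising \<open>s\<close> for the pair \<open>(x + y, R)\<close>: used for
    both pairs on the left, it gives equality on the right.\<close>
  define s where "s = R / (R + (x + y))"
  have pos: "R + (x + y) > 0" using x r by linarith
  have "(x + y) * R / (R + (x + y)) = (x + y) * s\<^sup>2 + R * (1 - s)\<^sup>2"
    using pos unfolding s_def by (simp add: divide_simps power2_eq_square) (simp add: algebra_simps)
  moreover have "(r + q) * (1 - s)\<^sup>2 \<le> R * (1 - s)\<^sup>2" using r by (intro mult_right_mono) auto
  ultimately show ?thesis
    using min[OF x(1) r(1), of s] min[OF x(2) r(2), of s] by (simp add: distrib_right)
qed

text \<open>Induction on the order for all index sets at once: the summands in
  \<open>esym_ratio_Suc\<close> are parallel sums, and the induction hypothesis on
  \<open>S - {i}\<close> is the condition \<open>r + q \<le> R\<close> of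
  \<open>parallel_sum_superadditive\<close>.\<close>

theorem esym_ratio_superadditive:
  assumes "finite S" "k \<le> card S" "\<And>i. i \<in> S \<Longrightarrow> x i > 0" "\<And>i. i \<in> S \<Longrightarrow> y i > 0"
  shows "esym_ratio S k x + esym_ratio S k y \<le> esym_ratio S k (\<lambda>i. x i + y i)"
  using assms
proof (induction k arbitrary: S)
  case 0
  then show ?case by (simp add: esym_ratio_def esym_0 esym_1 sum.distrib)
next
  case (Suc k)
  note x = Suc.prems(3) and y = Suc.prems(4)
  have "(real k + 2) * (esym_ratio S (Suc k) x + esym_ratio S (Suc k) y) =
      (\<Sum>i\<in>S. x i * esym_ratio (S - {i}) k x / (esym_ratio (S - {i}) k x + x i)
        + y i * esym_ratio (S - {i}) k y / (esym_ratio (S - {i}) k y + y i))"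
    using Suc.prems by (simp add: distrib_left esym_ratio_Suc sum.distrib)
  also have "\<dots> \<le> (\<Sum>i\<in>S. (x i + y i) * esym_ratio (S - {i}) k (\<lambda>i. x i + y i)
        / (esym_ratio (S - {i}) k (\<lambda>i. x i + y i) + (x i + y i)))"
    using Suc.prems
    by (intro sum_mono parallel_sum_superadditive esym_ratio_nonneg Suc.IH) (auto simp: less_imp_le)
  also have "\<dots> = (real k + 2) * esym_ratio S (Suc k) (\<lambda>i. x i + y i)"
    using Suc.prems by (subst esym_ratio_Suc) (auto simp: add_pos_pos)
  finally show ?case by (rule mult_left_le_imp_le) simp
qed

text \<open>Along the ray from \<open>x\<close> in direction \<open>y\<close>, superadditivity and
  homogeneity bound each ratio below by an affine function of \<open>t\<close>. The product of these
  bounds agrees with \<open>esym S (Suc k)\<close> at \<open>t = 0\<close> and is at most that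
  polynomial for \<open>t > 0\<close>, so the derivatives at 0 are ordered the same way.\<close>

lemma esym_deriv_ge:
  assumes S: "finite S" "Suc k \<le> card S" and x: "\<And>i. i \<in> S \<Longrightarrow> x i > 0" and y: "\<And>i. i \<in> S \<Longrightarrow> y i > 0"
  shows "esym S (Suc k) x * (\<Sum>j<Suc k. esym_ratio S j y / esym_ratio S j x) \<le> esym_deriv S k x y"
proof -
  let ?r = "esym_ratio S"
  define f where "f t = esym S (Suc k) (\<lambda>i. x i + t * y i) - (\<Prod>j<Suc k. ?r j x + t * ?r j y)" for t
  have rpos: "?r j x > 0" if "j < Suc k" for j using S x that by (intro esym_ratio_pos) auto
  have f_nonneg: "f t \<ge> 0" if t: "t > 0" for t
  proof -
    have hom: "esym S n (\<lambda>i. t * y i) = t ^ n * esym S n y" for n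
      unfolding esym_def sum_distrib_left by (rule sum.cong) (auto simp: prod.distrib)
    have "?r j x + t * ?r j y \<le> ?r j (\<lambda>i. x i + t * y i)" if "j < Suc k" for j
      using esym_ratio_superadditive[of S j x "\<lambda>i. t * y i"] S x y t that
      by (simp add: esym_ratio_def hom)
    then have "(\<Prod>j<Suc k. ?r j x + t * ?r j y) \<le> (\<Prod>j<Suc k. ?r j (\<lambda>i. x i + t * y i))"
      using t by (auto intro!: prod_mono add_nonneg_nonneg mult_nonneg_nonneg esym_ratio_nonneg less_imp_le[OF x] less_imp_le[OF y]
          simp del: prod.lessThan_Suc)
    also have "\<dots> = esym S (Suc k) (\<lambda>i. x i + t * y i)"
      using S x y t by (intro esym_eq_prod_ratio[symmetric]) (auto intro!: add_pos_pos)
    finally show ?thesis by (simp add: f_def)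
  qed
  have f0: "f 0 = 0" using S x by (simp add: f_def esym_eq_prod_ratio del: prod.lessThan_Suc)
  have prod_deriv: "((\<lambda>t. \<Prod>j<Suc k. ?r j x + t * ?r j y) has_real_derivative
      (\<Sum>j<Suc k. ?r j y * (\<Prod>i\<in>{..<Suc k} - {j}. ?r i x + 0 * ?r i y))) (at 0)"
    by (rule has_field_derivative_prod) (auto intro!: derivative_eq_intros)
  have "(\<Sum>j<Suc k. ?r j y * (\<Prod>i\<in>{..<Suc k} - {j}. ?r i x + 0 * ?r i y)) =
      (\<Sum>j<Suc k. esym S (Suc k) x * (?r j y / ?r j x))"
  proof (rule sum.cong[OF refl])
    fix j assume j: "j \<in> {..<Suc k}"
    have "esym S (Suc k) x = ?r j x * (\<Prod>i\<in>{..<Suc k} - {j}. ?r i x)"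
      using prod.remove[OF _ j, of "\<lambda>i. ?r i x"] esym_eq_prod_ratio[of S "Suc k" x] S x by simp
    then show "?r j y * (\<Prod>i\<in>{..<Suc k} - {j}. ?r i x + 0 * ?r i y) = esym S (Suc k) x * (?r j y / ?r j x)"
      using rpos[of j] j by simp
  qed
  then have der: "(f has_real_derivative esym_deriv S k x y - esym S (Suc k) x * (\<Sum>j<Suc k. ?r j y / ?r j x)) (at 0)"
    using DERIV_diff[OF esym_has_derivative[OF S(1), of k x y 0] prod_deriv]
    unfolding f_def sum_distrib_left by simp
  show ?thesis
  proof (rule ccontr)
    assume "\<not> ?thesis"
    then obtain d where d: "d > 0" "\<And>h. 0 < h \<Longrightarrow> h < d \<Longrightarrow> f (0 + h) < f 0"
      using DERIV_neg_dec_right[OF der] by auto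
    have "f (d / 2) < 0" using d(1) d(2)[of "d / 2"] f0 by simp
    then show False using f_nonneg[of "d / 2"] d(1) by simp
  qed
qed

text \<open>Here \<open>w\<close> is the gradient at \<open>x\<close> of the \<open>k\<close>-th
  root of \<open>esym S k\<close>. Euler's identity gives the value at \<open>x\<close>; the
  inequality comes from \<open>esym_deriv_ge\<close> and the arithmetic-geometric mean inequality.
  Positivity of \<open>w\<close> is recorded because its logarithm is taken later.\<close>

theorem esym_root_supporting_functional:
  fixes S :: "'a set"
  assumes S: "finite S" and k: "1 \<le> k" "k \<le> card S" and x: "\<And>i. i \<in> S \<Longrightarrow> x i > 0"
  obtains w where "\<And>i. i \<in> S \<Longrightarrow> w i > 0" "(\<Sum>i\<in>S. w i * x i) = root k (esym S k x)"
    "\<And>y. (\<And>i. i \<in> S \<Longrightarrow> y i > 0) \<Longrightarrow> root k (esym S k y) \<le> (\<Sum>i\<in>S. w i * y i)"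
proof -
  obtain n where n: "k = Suc n" using k by (cases k) auto
  let ?r = "esym_ratio S"
  define P where "P = esym S k x"
  define g where "g = root k P"
  have P: "P > 0" unfolding P_def using S k x by (intro esym_pos) auto
  have g: "g > 0" "g ^ k = P" unfolding g_def using P k by simp_all
  \<comment> \<open>The chain rule: a partial derivative of \<open>esym S k\<close>, divided by
    \<open>k\<close> times the power \<open>k - 1\<close> of the root.\<close>
  define w where "w i = esym (S - {i}) n x / (k * g ^ n)" for i
  have w_sum: "(\<Sum>i\<in>S. w i * y i) = esym_deriv S n x y / (k * g ^ n)" for y
    by (simp add: w_def esym_deriv_def sum_divide_distrib mult.commute)
  show ?thesis
  proof
    fix i assume "i \<in> S"
    then have "esym (S - {i}) n x > 0" using S k x n by (intro esym_pos) auto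
    then show "w i > 0" using g k by (simp add: w_def)
  next
    have "esym_deriv S n x x = k * P" by (simp add: esym_euler[OF S] P_def n add.commute)
    then have "(\<Sum>i\<in>S. w i * x i) = P / g ^ n"
      using k by (simp add: w_sum)
    also have "\<dots> = g" using g by (simp add: n flip: g(2))
    finally show "(\<Sum>i\<in>S. w i * x i) = root k (esym S k x)" by (simp add: g_def P_def)
  next
    fix y :: "'a \<Rightarrow> real" assume y: "\<And>i. i \<in> S \<Longrightarrow> y i > 0"
    define Q where "Q = esym S k y"
    have Q: "Q > 0" unfolding Q_def using S k y by (intro esym_pos) auto
    have rpos: "?r j x > 0" "?r j y > 0" if "j < k" for j
      using S x y that k by (auto intro!: esym_ratio_pos)
    \<comment> \<open>The quotients of ratios have geometric mean \<open>root k (Q / P)\<close>,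
      while their sum is what bounds the derivative in \<open>esym_deriv_ge\<close>.\<close>
    have "(\<Prod>j<k. ?r j y / ?r j x) = Q / P"
      using S x y k by (simp add: prod_dividef esym_eq_prod_ratio P_def Q_def)
    then have "(Q / P) powr (1 / k) \<le> (\<Sum>j<k. (?r j y / ?r j x) / k)"
      using arith_geom_mean[of "{..<k}" "\<lambda>j. ?r j y / ?r j x"] rpos k
      by (auto simp: less_imp_le lessThan_empty_iff)
    then have "(Q / P) powr (1 / k) * k \<le> (\<Sum>j<k. ?r j y / ?r j x)"
      using k unfolding sum_divide_distrib[symmetric] by (simp add: pos_le_divide_eq)
    then have "root k (Q / P) * k \<le> (\<Sum>j<k. ?r j y / ?r j x)"
      using P Q k by (simp add: root_powr_inverse inverse_eq_divide)
    then have le: "P * (root k (Q / P) * k) \<le> esym_deriv S n x y"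
      using esym_deriv_ge[of S n x y] S k x y P unfolding P_def n
      by (meson dual_order.trans less_imp_le mult_left_mono)
    have "P * (root k (Q / P) * k) = root k Q * (k * g ^ n)"
    proof -
      have "P * (root k Q / g) = root k Q * g ^ n" using g(1) by (simp add: n field_simps flip: g(2))
      then have "P * (root k Q / g) * k = root k Q * g ^ n * k" by (simp only:)
      then show ?thesis by (simp add: real_root_divide g_def mult_ac)
    qed
    from le[unfolded this] have "root k Q \<le> esym_deriv S n x y / (k * g ^ n)"
      by (subst pos_le_divide_eq) (use g k in simp_all)
    then show "root k (esym S k y) \<le> (\<Sum>i\<in>S. w i * y i)"
      by (simp only: w_sum Q_def)
  qed
qed

subsection \<open>Elementary symmetric functions of the eigenvalues\<close>

text \<open>Equal products have the same multiset of roots, and two families enumerating one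
  multiset differ by a permutation.\<close>

lemma linear_factors_permutation:
  fixes a b :: "'n::finite \<Rightarrow> complex"
  assumes "(\<Prod>i\<in>UNIV. [:- a i, 1:]) = (\<Prod>i\<in>UNIV. [:- b i, 1:])"
  obtains p where "p permutes UNIV" "\<And>i. a i = b (p i)"
proof -
  have roots: "proots (\<Prod>i\<in>UNIV. [:- c i, 1:]) = image_mset c (mset_set UNIV)" for c :: "'n \<Rightarrow> complex"
    by (subst proots_prod) (simp_all add: sum_unfold_sum_mset)
  have "image_mset a (mset_set UNIV) = image_mset b (mset_set UNIV)"
    using assms by (simp flip: roots)
  from image_mset_eq_implies_permutes[OF finite this] show ?thesis using that by auto
qed

text \<open>Evaluation replaces a determinant over polynomials by one over \<open>complex\<close>,
  where unitary factors cancel by multiplicativity.\<close>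

lemma poly_charpoly: "poly (charpoly A) z = det (mat z - A)"
  by (simp add: charpoly_def det_def poly_sum poly_prod mat_def) (intro sum.cong refl arg_cong2[of _ _ _ _ "(*)"] prod.cong, auto)

lemma charpoly_conj_diag:
  fixes U :: "complex^'n^'n"
  assumes U: "unitary_mat U"
  shows "charpoly (U ** diag_real d ** adjoint_mat U) = (\<Prod>i\<in>UNIV. [:- of_real (d i), 1:])"
proof -
  have "poly (charpoly (U ** diag_real d ** adjoint_mat U)) z = poly (\<Prod>i\<in>UNIV. [:- of_real (d i), 1:]) z" for z
  proof -
    have comm: "U ** mat z = mat z ** U"
      by (simp add: vec_eq_iff matrix_matrix_mult_def mat_def if_distrib if_distribR mult.commute cong: if_cong)
    have "mat z - U ** diag_real d ** adjoint_mat U = U ** (mat z - diag_real d) ** adjoint_mat U"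
    proof -
      have "U ** mat z ** adjoint_mat U = mat z"
        by (simp only: comm unitary_cancel[OF U])
      then show ?thesis by (simp add: matrix_diff_distrib)
    qed
    then have "poly (charpoly (U ** diag_real d ** adjoint_mat U)) z = det U * det (adjoint_mat U) * det (mat z - diag_real d)"
      by (simp add: poly_charpoly det_mul)
    also have "det U * det (adjoint_mat U) = 1"
      by (metis U det_I det_mul unitaryD(2))
    also have "det (mat z - diag_real d) = (\<Prod>i\<in>UNIV. z - of_real (d i))"
      by (subst det_diagonal) (auto simp: mat_def diag_real_def)
    finally show ?thesis by (simp add: poly_prod)
  qed
  then show ?thesis by (simp add: poly_eq_poly_eq_iff[symmetric] fun_eq_iff)
qed

lemma sum_subsets_permute:
  fixes p :: "'n::finite \<Rightarrow> 'n"
  assumes "p permutes UNIV"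
  shows "(\<Sum>I | card I = k. \<Prod>i\<in>I. f (p i)) = (\<Sum>I | card I = k. \<Prod>i\<in>I. f i)"
proof (rule sum.reindex_bij_witness[of _ "\<lambda>I. inv p ` I" "\<lambda>I. p ` I"])
  have p: "inj p" "inj (inv p)" "p (inv p i) = i" "inv p (p i) = i" for i
    using assms permutes_inj permutes_inj[OF permutes_inv[OF assms]] permutes_inverses by metis+
  show "inv p ` p ` I = I" "p ` inv p ` I = I" for I by (auto simp: image_image p)
  show "p ` I \<in> {I. card I = k}" if "I \<in> {I. card I = k}" for I
    using that p by (simp add: card_image inj_on_subset)
  show "inv p ` I \<in> {I. card I = k}" if "I \<in> {I. card I = k}" for I
    using that p by (simp add: card_image inj_on_subset)
  show "(\<Prod>i\<in>p ` I. f i) = (\<Prod>i\<in>I. f (p i))" for I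
    using p(1) by (subst prod.reindex) (auto intro: inj_on_subset)
qed

text \<open>The enumeration \<open>eigenvalues\<close> is an arbitrary choice, but the
  characteristic polynomial fixes it up to a permutation, and the sum over all index sets of size
  \<open>k\<close> is invariant under permutations.\<close>

lemma Tr_k_conj_diag:
  assumes "unitary_mat U"
  shows "Tr_k k (U ** diag_real d ** adjoint_mat U) = of_real (esym UNIV k d)"
proof -
  let ?A = "U ** diag_real d ** adjoint_mat U"
  have "(\<Prod>i\<in>UNIV. [:- eigenvalues ?A i, 1:]) = (\<Prod>i\<in>UNIV. [:- of_real (d i), 1:])"
    by (simp flip: charpoly_eigenvalues add: charpoly_conj_diag[OF assms])
  then obtain p where p: "p permutes UNIV" "\<And>i. eigenvalues ?A i = of_real (d (p i))"
    using linear_factors_permutation[of "eigenvalues ?A" "\<lambda>i. of_real (d i)"] by metis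
  show ?thesis
    using sum_subsets_permute[OF p(1), where k = k and f = "\<lambda>i. complex_of_real (d i)"]
    by (simp add: Tr_k_def p(2) esym_def)
qed

lemma phi_conj_diag:
  "unitary_mat U \<Longrightarrow> phi k (U ** diag_real d ** adjoint_mat U) = root k (esym UNIV k d)"
  by (simp add: phi_def Tr_k_conj_diag)

lemma esym_permute:
  fixes p :: "'n::finite \<Rightarrow> 'n"
  shows "p permutes UNIV \<Longrightarrow> esym UNIV k (\<lambda>i. x (p i)) = esym UNIV k x"
  using sum_subsets_permute[where p = p and k = k and f = x] by (simp add: esym_def)

subsection \<open>Continuity of the functional calculus\<close>

lemma tendsto_matrix_mult:
  fixes A :: "'a \<Rightarrow> complex^'n^'m" and B :: "'a \<Rightarrow> complex^'k^'n"
  assumes "(A \<longlongrightarrow> A0) F" "(B \<longlongrightarrow> B0) F"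
  shows "((\<lambda>x. A x ** B x) \<longlongrightarrow> A0 ** B0) F"
  unfolding matrix_matrix_mult_def
  by (intro tendsto_vec_lambda tendsto_sum tendsto_mult tendsto_vec_nth assms)

lemma tendsto_adjoint_mat:
  assumes "(A \<longlongrightarrow> A0) F"
  shows "((\<lambda>x. adjoint_mat (A x)) \<longlongrightarrow> adjoint_mat A0) F"
  unfolding adjoint_mat_def
  by (intro tendsto_vec_lambda tendsto_cnj tendsto_vec_nth assms)

lemma tendsto_diag_real:
  assumes "\<And>i. ((\<lambda>x. d x i) \<longlongrightarrow> d0 i) F"
  shows "((\<lambda>x. diag_real (d x)) \<longlongrightarrow> diag_real d0) F"
  unfolding diag_real_def
proof (intro tendsto_vec_lambda)
  fix i j
  show "((\<lambda>x. if i = j then complex_of_real (d x i) else 0) \<longlongrightarrow> (if i = j then complex_of_real (d0 i) else 0)) F"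
    using assms by (auto intro: tendsto_of_real)
qed

lemma tendsto_trace:
  fixes A :: "'a \<Rightarrow> complex^'n^'n"
  assumes "(A \<longlongrightarrow> A0) F"
  shows "((\<lambda>x. trace (A x)) \<longlongrightarrow> trace A0) F"
  unfolding trace_def by (intro tendsto_sum tendsto_vec_nth assms)

lemma compact_unitary: "compact {U :: complex^'n^'n. unitary_mat U}"
proof -
  have "norm U \<le> (\<Sum>i\<in>(UNIV::'n set). \<Sum>j\<in>(UNIV::'n set). 1)" if U: "unitary_mat U" for U :: "complex^'n^'n"
  proof -
    have entry: "norm (U $ i $ j) \<le> 1" for i j
    proof -
      have "(cmod (U $ i $ j))\<^sup>2 \<le> (\<Sum>j\<in>UNIV. (cmod (U $ i $ j))\<^sup>2)"
        by (rule member_le_sum) auto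
      then have "(cmod (U $ i $ j))\<^sup>2 \<le> 1" by (simp add: unitary_row_norm[OF U])
      then show ?thesis by (simp add: abs_square_le_1)
    qed
    have "norm U \<le> (\<Sum>i\<in>UNIV. norm (U $ i))" unfolding norm_vec_def by (rule L2_set_le_sum) simp
    also have "\<dots> \<le> (\<Sum>i\<in>UNIV. \<Sum>j\<in>UNIV. norm (U $ i $ j))"
    proof (rule sum_mono)
      fix i show "norm (U $ i) \<le> (\<Sum>j\<in>UNIV. norm (U $ i $ j))"
        unfolding norm_vec_def[of "U $ i"] by (rule L2_set_le_sum) simp
    qed
    also have "\<dots> \<le> (\<Sum>i\<in>(UNIV::'n set). \<Sum>j\<in>(UNIV::'n set). 1)"
      by (intro sum_mono entry)
    finally show ?thesis .
  qed
  then have "bounded {U :: complex^'n^'n. unitary_mat U}" by (auto simp: bounded_iff)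
  moreover have "closed {U :: complex^'n^'n. unitary_mat U}"
    unfolding unitary_mat_def
    by (intro closed_Collect_conj closed_Collect_eq)
      (auto simp: continuous_on_def intro!: tendsto_matrix_mult tendsto_adjoint_mat)
  ultimately show ?thesis by (simp add: compact_eq_bounded_closed)
qed

text \<open>Diagonalising unitaries need not converge, but a subsequence does by compactness. The
  eigenvalues are the diagonal entries of \<open>adjoint_mat (U n) ** M n ** U n\<close>, so they
  converge along that subsequence as well.\<close>

lemma herm_fun_subseq:
  fixes M :: "nat \<Rightarrow> complex^'n^'n"
  assumes M: "\<And>n. M n \<in> Herm" "M \<longlonglongrightarrow> M0" and f: "continuous_on UNIV f"
  obtains r where "strict_mono r" "(\<lambda>n. herm_fun f (M (r n))) \<longlonglongrightarrow> herm_fun f M0"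
proof -
  have "\<exists>U d. unitary_mat U \<and> M n = U ** diag_real d ** adjoint_mat U" for n
    using spectral_theorem[OF M(1)[of n]] by metis
  then obtain U d where U: "\<And>n. unitary_mat (U n)" and Md: "\<And>n. M n = U n ** diag_real (d n) ** adjoint_mat (U n)"
    by metis
  obtain U0 r where U0: "unitary_mat U0" and r: "strict_mono r" and lim: "(U \<circ> r) \<longlonglongrightarrow> U0"
    using compact_unitary[unfolded compact_def, rule_format, of U] U by auto
  have Mr: "(\<lambda>n. M (r n)) \<longlonglongrightarrow> M0" using LIMSEQ_subseq_LIMSEQ[OF M(2) r] by (simp add: o_def)
  have Ur: "(\<lambda>n. U (r n)) \<longlonglongrightarrow> U0" using lim by (simp add: o_def)
  define d0 where "d0 i = Re ((adjoint_mat U0 ** M0 ** U0) $ i $ i)" for i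
  have "d n i = Re ((adjoint_mat (U n) ** M n ** U n) $ i $ i)" for n i
  proof -
    have "adjoint_mat (U n) ** M n ** U n = diag_real (d n)"
      by (simp add: Md unitary_cancel[OF U] flip: matrix_mul_assoc) (simp add: matrix_mul_assoc unitaryD[OF U])
    then show ?thesis by (simp add: diag_real_def)
  qed
  then have dr: "(\<lambda>n. d (r n) i) \<longlonglongrightarrow> d0 i" for i
    unfolding d0_def using Mr Ur
    by (auto intro!: tendsto_Re tendsto_vec_nth tendsto_matrix_mult tendsto_adjoint_mat)
  have conj_lim: "(\<lambda>n. U (r n) ** diag_real (e n) ** adjoint_mat (U (r n))) \<longlonglongrightarrow> U0 ** diag_real e0 ** adjoint_mat U0"
    if "\<And>i. (\<lambda>n. e n i) \<longlonglongrightarrow> e0 i" for e e0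
    using that Ur by (intro tendsto_matrix_mult tendsto_adjoint_mat tendsto_diag_real) auto
  have M0: "M0 = U0 ** diag_real d0 ** adjoint_mat U0"
  proof (rule LIMSEQ_unique[OF Mr])
    show "(\<lambda>n. M (r n)) \<longlonglongrightarrow> U0 ** diag_real d0 ** adjoint_mat U0"
      unfolding Md by (rule conj_lim[OF dr])
  qed
  have "(\<lambda>n. f (d (r n) i)) \<longlonglongrightarrow> f (d0 i)" for i
    by (rule continuous_on_tendsto_compose[OF f dr]) auto
  from conj_lim[of "\<lambda>n i. f (d (r n) i)" "\<lambda>i. f (d0 i)", OF this]
  have "(\<lambda>n. herm_fun f (M (r n))) \<longlonglongrightarrow> herm_fun f M0"
    by (simp add: herm_fun_diag[OF U Md] herm_fun_diag[OF U0 M0])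
  then show ?thesis using that r by blast
qed

text \<open>If convergence failed, some subsequence would stay at a fixed distance from the limit,
  contradicting \<open>herm_fun_subseq\<close> applied to it.\<close>

lemma herm_fun_tendsto:
  fixes M :: "nat \<Rightarrow> complex^'n^'n"
  assumes M: "\<And>n. M n \<in> Herm" "M \<longlonglongrightarrow> M0" and f: "continuous_on UNIV f"
  shows "(\<lambda>n. herm_fun f (M n)) \<longlonglongrightarrow> herm_fun f M0"
proof (rule ccontr)
  assume "\<not> ?thesis"
  then obtain e where e: "e > 0" "\<And>N. \<exists>n\<ge>N. dist (herm_fun f (M n)) (herm_fun f M0) \<ge> e"
    unfolding LIMSEQ_def by (metis not_less)
  let ?S = "{n. dist (herm_fun f (M n)) (herm_fun f M0) \<ge> e}"
  have "infinite ?S" unfolding infinite_nat_iff_unbounded_le using e(2) by auto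
  from infinite_enumerate[OF this] obtain s :: "nat \<Rightarrow> nat" where s: "strict_mono s" "\<And>n. s n \<in> ?S" by blast
  have "(\<lambda>n. M (s n)) \<longlonglongrightarrow> M0" using LIMSEQ_subseq_LIMSEQ[OF M(2) s(1)] by (simp add: o_def)
  then obtain r where "(\<lambda>n. herm_fun f (M (s (r n)))) \<longlonglongrightarrow> herm_fun f M0"
    using herm_fun_subseq[of "\<lambda>n. M (s n)" M0 f] M(1) f by metis
  then obtain n where "dist (herm_fun f (M (s (r n)))) (herm_fun f M0) < e"
    using e(1) by (auto simp: LIMSEQ_def)
  then show False using s(2)[of "r n"] by simp
qed

subsection \<open>Minimising over a unitary orbit\<close>

text \<open>Complex entries, unlike those of \<open>diag_real\<close>, accommodate the unimodular
  eigenvalues of unitary matrices.\<close>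

definition cdiag :: "('n \<Rightarrow> complex) \<Rightarrow> complex^'n^'n"
  where "cdiag d = (\<chi> i j. if i = j then d i else 0)"

lemma cdiag_mult: "cdiag a ** cdiag b = cdiag (\<lambda>i. a i * b i)"
  by (simp add: vec_eq_iff cdiag_def matrix_matrix_mult_def if_distrib[of "\<lambda>x. x * y" for y] cong: if_cong)

lemma adjoint_cdiag: "adjoint_mat (cdiag a) = cdiag (\<lambda>i. cnj (a i))"
  by (simp add: vec_eq_iff cdiag_def)

lemma tendsto_cdiag:
  assumes "\<And>i. ((\<lambda>x. d x i) \<longlongrightarrow> d0 i) F"
  shows "((\<lambda>x. cdiag (d x)) \<longlongrightarrow> cdiag d0) F"
  unfolding cdiag_def
proof (intro tendsto_vec_lambda)
  fix i j
  show "((\<lambda>x. if i = j then d x i else 0) \<longlongrightarrow> (if i = j then d0 i else 0)) F"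
    using assms by auto
qed

lemma exp_difference_quotient:
  assumes t: "t \<longlonglongrightarrow> 0" "\<And>n. t n \<noteq> 0"
  shows "(\<lambda>n. (exp (complex_of_real (t n) * z) - 1) / of_real (t n)) \<longlonglongrightarrow> z"
proof -
  have "((\<lambda>s. exp (s * z)) has_field_derivative z) (at 0)"
    by (auto intro!: derivative_eq_intros)
  then have "((\<lambda>s. (exp (s * z) - 1) / s) \<longlongrightarrow> z) (at 0)"
    by (simp add: has_field_derivative_iff)
  moreover have "filterlim (\<lambda>n. complex_of_real (t n)) (at 0) sequentially"
    unfolding filterlim_at using t tendsto_of_real[OF t(1)] by auto
  ultimately show ?thesis by (rule filterlim_compose)
qed

text \<open>The curve is the exponential of \<open>t n\<close> times \<open>C\<close>, built
  spectrally: \<open>\<i>\<close> times \<open>C\<close> is Hermitian, so a unitary diagonalises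
  \<open>C\<close> with purely imaginary eigenvalues, whose exponentials are unimodular.\<close>

lemma skew_hermitian_generates_unitaries:
  fixes C :: "complex^'n^'n"
  assumes C: "adjoint_mat C = - C" and t: "t \<longlonglongrightarrow> 0" "\<And>n. t n \<noteq> 0"
  obtains V where "\<And>n. unitary_mat (V n)" "V \<longlonglongrightarrow> mat 1" "(\<lambda>n. (1 / t n) *\<^sub>R (V n - mat 1)) \<longlonglongrightarrow> C"
proof -
  define D :: "complex^'n^'n" where "D = (\<chi> i j. \<i> * C $ i $ j)"
  have "D \<in> Herm"
    using C by (simp add: D_def Herm_def vec_eq_iff)
  then obtain W c where W: "unitary_mat W" and D: "D = W ** diag_real c ** adjoint_mat W"
    using spectral_theorem by blast
  define z where "z i = - \<i> * complex_of_real (c i)" for i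
  have CW: "C = W ** cdiag z ** adjoint_mat W"
  proof -
    have "C $ i $ j = - \<i> * D $ i $ j" for i j by (simp add: D_def)
    moreover have "(W ** cdiag z ** adjoint_mat W) $ i $ j = - \<i> * (W ** diag_real c ** adjoint_mat W) $ i $ j" for i j
    proof -
      have "(W ** cdiag z) $ i $ k = - \<i> * (W ** diag_real c) $ i $ k" for k
        by (simp add: matrix_matrix_mult_def[of W] cdiag_def diag_real_def z_def if_distrib cong: if_cong)
      then show ?thesis
        by (simp only: matrix_matrix_mult_def[of _ "adjoint_mat W"] vec_lambda_beta sum_distrib_left mult.assoc)
    qed
    ultimately show ?thesis by (simp add: vec_eq_iff D)
  qed
  define V where "V n = W ** cdiag (\<lambda>i. exp (of_real (t n) * z i)) ** adjoint_mat W" for n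
  have id: "mat 1 = W ** cdiag (\<lambda>_. 1) ** adjoint_mat W"
  proof -
    have "cdiag (\<lambda>_. 1) = (mat 1 :: complex^'n^'n)" by (simp add: vec_eq_iff cdiag_def mat_def)
    then show ?thesis by (simp add: unitaryD[OF W])
  qed
  have mult: "(W ** cdiag a ** adjoint_mat W) ** (W ** cdiag b ** adjoint_mat W) = W ** cdiag (\<lambda>i. a i * b i) ** adjoint_mat W" for a b
  proof -
    have "(W ** cdiag a ** adjoint_mat W) ** (W ** cdiag b ** adjoint_mat W) = W ** (cdiag a ** cdiag b) ** adjoint_mat W"
      by (simp only: matrix_mul_assoc unitary_cancel[OF W])
    then show ?thesis by (simp only: cdiag_mult)
  qed
  have adj: "adjoint_mat (W ** cdiag a ** adjoint_mat W) = W ** cdiag (\<lambda>i. cnj (a i)) ** adjoint_mat W" for a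
    by (simp add: adjoint_mult adjoint_cdiag matrix_mul_assoc)
  have "unitary_mat (V n)" for n
  proof -
    have "cnj (z i) = - z i" for i by (simp add: z_def)
    then have "cnj (exp (of_real (t n) * z i)) * exp (of_real (t n) * z i) = 1" for i
      by (simp add: exp_cnj flip: exp_add)
    then show ?thesis
      unfolding unitary_mat_def V_def adj mult by (simp add: id mult.commute)
  qed
  moreover have "V \<longlonglongrightarrow> mat 1"
  proof -
    have "(\<lambda>n. exp (of_real (t n) * z i)) \<longlonglongrightarrow> exp (of_real 0 * z i)" for i
      by (intro tendsto_intros t)
    then have "(\<lambda>n. exp (of_real (t n) * z i)) \<longlonglongrightarrow> 1" for i by simp
    then show ?thesis unfolding V_def id by (intro tendsto_matrix_mult tendsto_const tendsto_cdiag)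
  qed
  moreover have "(\<lambda>n. (1 / t n) *\<^sub>R (V n - mat 1)) \<longlonglongrightarrow> C"
  proof -
    have "(1 / t n) *\<^sub>R (V n - mat 1) = W ** cdiag (\<lambda>i. (exp (of_real (t n) * z i) - 1) / of_real (t n)) ** adjoint_mat W" for n
    proof -
      have "cdiag (\<lambda>i. (exp (of_real (t n) * z i) - 1) / of_real (t n)) =
          (1 / t n) *\<^sub>R (cdiag (\<lambda>i. exp (of_real (t n) * z i)) - cdiag (\<lambda>_. 1))"
        by (simp add: vec_eq_iff cdiag_def) (simp add: scaleR_conv_of_real)
      then show ?thesis
        by (simp add: V_def id matrix_diff_distrib matrix_scalar_ac scaleR_diff_right
            flip: scalar_matrix_assoc)
    qed
    moreover have "(\<lambda>n. W ** cdiag (\<lambda>i. (exp (of_real (t n) * z i) - 1) / of_real (t n)) ** adjoint_mat W) \<longlonglongrightarrow> C"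
      unfolding CW by (intro tendsto_matrix_mult tendsto_const tendsto_cdiag exp_difference_quotient t)
    ultimately show ?thesis by simp
  qed
  ultimately show ?thesis using that by blast
qed

text \<open>Gibbs' inequality for \<open>M\<close>, tested with \<open>herm_exp (M + E)\<close>.
  This first-order bound on the increment takes the place of a derivative of the trace
  exponential.\<close>

lemma trace_exp_add_le:
  assumes M: "M \<in> Herm" and E: "E \<in> Herm"
  shows "Re (trace (herm_exp (M + E))) \<le> Re (trace (herm_exp M)) + Re (trace (herm_exp (M + E) ** E))"
proof -
  have ME: "M + E \<in> Herm" using M E by (rule Herm_add)
  from gibbs_variational_inequality[OF M herm_exp_HPD[OF ME]] show ?thesis
    by (simp add: herm_log_exp[OF ME] matrix_add_ldistrib trace_add)
qed

lemma continuous_on_trace_exp_orbit: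
  fixes L K :: "complex^'n^'n"
  assumes L: "L \<in> Herm" and K: "K \<in> Herm"
  shows "continuous_on S (\<lambda>U. Re (trace (herm_exp (L + U ** K ** adjoint_mat U))))"
  unfolding continuous_on_sequentially o_def
proof safe
  fix U :: "nat \<Rightarrow> complex^'n^'n" and U0 assume lim: "U \<longlonglongrightarrow> U0"
  have "(\<lambda>n. herm_exp (L + U n ** K ** adjoint_mat (U n))) \<longlonglongrightarrow> herm_exp (L + U0 ** K ** adjoint_mat U0)"
    by (intro herm_fun_tendsto Herm_add Herm_conj L K continuous_on_exp continuous_on_id tendsto_add tendsto_const
        tendsto_matrix_mult tendsto_adjoint_mat lim)
  then show "(\<lambda>n. Re (trace (herm_exp (L + U n ** K ** adjoint_mat (U n))))) \<longlonglongrightarrow> Re (trace (herm_exp (L + U0 ** K ** adjoint_mat U0)))"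
    by (intro tendsto_Re tendsto_trace)
qed

text \<open>The derivative of the trace along the curve of conjugates of \<open>K\<close> with velocity \<open>C = [K, exp (L + K)]\<close>
  is \<open>- \<parallel>C\<parallel>\<^sup>2\<close>, so \<open>C = 0\<close> at a minimum.\<close>

lemma orbit_minimum_commutes:
  fixes L K :: "complex^'n^'n"
  assumes L: "L \<in> Herm" and K: "K \<in> Herm"
    and min: "\<And>V. unitary_mat V \<Longrightarrow> Re (trace (herm_exp (L + K))) \<le> Re (trace (herm_exp (L + V ** K ** adjoint_mat V)))"
  shows "K ** herm_exp (L + K) = herm_exp (L + K) ** K"
proof -
  define X where "X = herm_exp (L + K)"
  define C where "C = K ** X - X ** K"
  have LK: "L + K \<in> Herm" using L K by (rule Herm_add)
  have X: "X \<in> Herm" unfolding X_def using LK by (rule herm_fun_Herm)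
  have C_adj: "adjoint_mat C = - C"
    by (simp add: C_def adjoint_diff adjoint_mult HermD[OF K] HermD[OF X])
  define t where "t n = 1 / real (Suc n)" for n
  have t: "t \<longlonglongrightarrow> 0" "\<And>n. t n \<noteq> 0" "\<And>n. t n > 0"
    unfolding t_def using LIMSEQ_inverse_real_of_nat by (simp_all add: inverse_eq_divide del: of_nat_Suc)
  obtain V where V: "\<And>n. unitary_mat (V n)" "V \<longlonglongrightarrow> mat 1" "(\<lambda>n. (1 / t n) *\<^sub>R (V n - mat 1)) \<longlonglongrightarrow> C"
    by (rule skew_hermitian_generates_unitaries[OF C_adj t(1,2)]) (rule that)
  define E where "E n = V n ** K ** adjoint_mat (V n) - K" for n
  have E: "E n \<in> Herm" for n unfolding E_def using K by (intro Herm_diff Herm_conj)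
  have E_eq: "(1 / t n) *\<^sub>R E n = ((1 / t n) *\<^sub>R (V n - mat 1)) ** K ** adjoint_mat (V n)
      + K ** adjoint_mat ((1 / t n) *\<^sub>R (V n - mat 1))" for n
  proof -
    have "E n = (V n - mat 1) ** K ** adjoint_mat (V n) + K ** adjoint_mat (V n - mat 1)"
      by (simp add: E_def matrix_diff_distrib adjoint_diff)
    then show ?thesis
      by (simp add: adjoint_scaleR matrix_scalar_ac scaleR_add_right flip: scalar_matrix_assoc)
  qed
  \<comment> \<open>Product rule at \<open>mat 1\<close>: the conjugates of \<open>K\<close> have
    velocity \<open>C ** K + K ** adjoint_mat C\<close>, and \<open>C\<close> is
    skew-Hermitian.\<close>
  have E_deriv: "(\<lambda>n. (1 / t n) *\<^sub>R E n) \<longlonglongrightarrow> C ** K - K ** C"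
  proof -
    have "(\<lambda>n. (1 / t n) *\<^sub>R E n) \<longlonglongrightarrow> C ** K ** adjoint_mat (mat 1) + K ** adjoint_mat C"
      unfolding E_eq by (intro tendsto_add tendsto_matrix_mult tendsto_adjoint_mat tendsto_const V)
    moreover have "K ** (- C) = - (K ** C)"
      by (simp add: vec_eq_iff matrix_matrix_mult_def sum_negf)
    ultimately show ?thesis by (simp add: C_adj)
  qed
  have E0: "E \<longlonglongrightarrow> 0"
  proof -
    have "E \<longlonglongrightarrow> mat 1 ** K ** adjoint_mat (mat 1) - K"
      unfolding E_def by (intro tendsto_diff tendsto_matrix_mult tendsto_adjoint_mat tendsto_const V)
    then show ?thesis by simp
  qed
  have X_lim: "(\<lambda>n. herm_exp (L + K + E n)) \<longlonglongrightarrow> X"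
  proof -
    have "(\<lambda>n. L + K + E n) \<longlonglongrightarrow> L + K + 0" by (intro tendsto_add tendsto_const E0)
    then show ?thesis unfolding X_def
      by (intro herm_fun_tendsto Herm_add LK E continuous_on_exp continuous_on_id) simp
  qed
  \<comment> \<open>Minimality makes the increment of the trace nonnegative, and
    \<open>trace_exp_add_le\<close> bounds it by the trace against \<open>E n\<close>; dividing by
    \<open>t n > 0\<close> prepares the limit.\<close>
  have nonneg: "0 \<le> Re (trace (herm_exp (L + K + E n) ** ((1 / t n) *\<^sub>R E n)))" for n
  proof -
    have eq: "L + K + E n = L + V n ** K ** adjoint_mat (V n)" by (simp add: E_def)
    have "0 \<le> Re (trace (herm_exp (L + K + E n) ** E n))"
      using trace_exp_add_le[OF LK E[of n]] min[OF V(1)[of n], folded eq] by linarith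
    then show ?thesis
      using t(3)[of n] by (simp add: matrix_scalar_ac trace_scaleR flip: scalar_matrix_assoc)
  qed
  have "(\<lambda>n. Re (trace (herm_exp (L + K + E n) ** ((1 / t n) *\<^sub>R E n)))) \<longlonglongrightarrow> Re (trace (X ** (C ** K - K ** C)))"
    by (intro tendsto_Re tendsto_trace tendsto_matrix_mult X_lim E_deriv)
  then have "0 \<le> Re (trace (X ** (C ** K - K ** C)))"
    using nonneg by (intro LIMSEQ_le_const) auto
  \<comment> \<open>By cyclicity the commutator with \<open>K\<close> moves from \<open>C\<close> to
    \<open>X\<close>, and the commutator of \<open>K\<close> with \<open>X\<close> is
    \<open>C\<close> itself.\<close>
  also have "trace (X ** (C ** K - K ** C)) = trace (C ** C)"
  proof -
    have "trace (X ** (C ** K)) = trace (C ** (K ** X))" "trace (X ** (K ** C)) = trace (C ** (X ** K))"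
      by (simp_all add: trace_mul_sym[of C] trace_mul_sym[of X] matrix_mul_assoc)
        (metis matrix_mul_assoc trace_mul_sym)+
    moreover have "trace (C ** C) = trace (C ** (K ** X)) - trace (C ** (X ** K))"
      by (subst (2) C_def) (simp add: matrix_diff_distrib trace_sub)
    ultimately show ?thesis by (simp add: matrix_diff_distrib trace_sub)
  qed
  also have "Re (trace (C ** C)) = - (\<Sum>i\<in>UNIV. \<Sum>j\<in>UNIV. (cmod (C $ i $ j))\<^sup>2)"
  proof -
    have cnj: "C $ j $ i = - cnj (C $ i $ j)" for i j
      using C_adj by (simp add: vec_eq_iff)
    have "(C ** C) $ i $ i = of_real (- (\<Sum>j\<in>UNIV. (cmod (C $ i $ j))\<^sup>2))" for i
    proof -
      have "(C ** C) $ i $ i = (\<Sum>j\<in>UNIV. C $ i $ j * - cnj (C $ i $ j))"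
        unfolding matrix_matrix_mult_def vec_lambda_beta
        by (intro sum.cong refl arg_cong2[of _ _ _ _ "(*)"] cnj)
      then show ?thesis by (simp add: sum_negf flip: complex_norm_square)
    qed
    then show ?thesis by (simp add: trace_def sum_negf)
  qed
  finally have "(\<Sum>i\<in>UNIV. \<Sum>j\<in>UNIV. (cmod (C $ i $ j))\<^sup>2) \<le> 0" by simp
  then have "(\<Sum>i\<in>UNIV. \<Sum>j\<in>UNIV. (cmod (C $ i $ j))\<^sup>2) = 0"
    by (intro antisym sum_nonneg) auto
  then have "C = 0" by (simp add: sum_nonneg_eq_0_iff sum_nonneg vec_eq_iff)
  then show ?thesis by (simp add: C_def X_def)
qed

text \<open>Replacing \<open>U\<close> by a minimiser \<open>V\<close> only lowers the right side,
  and there the rotated logarithm \<open>K\<close> commutes with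
  \<open>X = herm_exp (L + K)\<close>. In a common eigenbasis \<open>L\<close> is diagonal too, the
  trace is the sum of the eigenvalues \<open>x i\<close> of \<open>X\<close>, and
  \<open>dual\<close> applies to the eigenvalues \<open>x i / w (p i)\<close> of
  \<open>herm_exp L\<close>, suitably reordered.\<close>

theorem phi_exp_le_trace_exp:
  fixes L U :: "complex^'n^'n"
  assumes L: "L \<in> Herm" and U: "unitary_mat U" and w: "\<And>i. w i > 0"
    and dual: "\<And>y. (\<And>i. y i > 0) \<Longrightarrow> root k (esym UNIV k y) \<le> (\<Sum>i\<in>UNIV. w i * y i)"
  shows "phi k (herm_exp L) \<le> Re (trace (herm_exp (L + U ** diag_real (\<lambda>i. ln (w i)) ** adjoint_mat U)))"
proof -
  define f where "f V = Re (trace (herm_exp (L + V ** diag_real (\<lambda>i. ln (w i)) ** adjoint_mat V)))" for V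
  obtain V where V: "unitary_mat V" and V_min: "\<And>V'. unitary_mat V' \<Longrightarrow> f V \<le> f V'"
    using continuous_attains_inf[OF compact_unitary _ continuous_on_trace_exp_orbit[OF L Herm_diag_real, where S = "{U. unitary_mat U}"]] U
    unfolding f_def by (metis (no_types, lifting) empty_Collect_eq mem_Collect_eq)
  define K where "K = V ** diag_real (\<lambda>i. ln (w i)) ** adjoint_mat V"
  define X where "X = herm_exp (L + K)"
  have K: "K \<in> Herm" unfolding K_def by (intro Herm_conj Herm_diag_real)
  have LK: "L + K \<in> Herm" using L K by (rule Herm_add)
  have X: "X \<in> HPD" unfolding X_def using LK by (rule herm_exp_HPD)
  have "K ** X = X ** K"
    unfolding X_def
  proof (rule orbit_minimum_commutes[OF L K])
    fix Q :: "complex^'n^'n" assume Q: "unitary_mat Q"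
    show "Re (trace (herm_exp (L + K))) \<le> Re (trace (herm_exp (L + Q ** K ** adjoint_mat Q)))"
      using V_min[OF unitary_mult[OF Q V]] by (simp add: f_def K_def adjoint_mult matrix_mul_assoc)
  qed
  then obtain W \<kappa> x where W: "unitary_mat W" and KW: "K = W ** diag_real \<kappa> ** adjoint_mat W"
    and XW: "X = W ** diag_real x ** adjoint_mat W"
    using simultaneous_spectral_theorem[OF K HPD_Herm[OF X]] by metis
  have x: "x i > 0" for i using X HPD_conj_diag_iff[OF W] by (simp add: XW)
  \<comment> \<open>Both \<open>W\<close> and \<open>V\<close> diagonalise \<open>K\<close>, so
    \<open>\<kappa>\<close> lists the values \<open>ln (w i)\<close> up to a permutation.\<close>
  have "(\<Prod>i\<in>UNIV. [:- complex_of_real (\<kappa> i), 1:]) = (\<Prod>i\<in>UNIV. [:- complex_of_real (ln (w i)), 1:])"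
    using charpoly_conj_diag[OF W, of \<kappa>] charpoly_conj_diag[OF V, of "\<lambda>i. ln (w i)"] KW K_def by simp
  then obtain p where p: "p permutes UNIV" "\<And>i. complex_of_real (\<kappa> i) = complex_of_real (ln (w (p i)))"
    using linear_factors_permutation[of "\<lambda>i. complex_of_real (\<kappa> i)"] by metis
  have \<kappa>: "exp (\<kappa> i) = w (p i)" for i using p(2)[of i] w by simp
  have "L = herm_log X - K" using herm_log_exp[OF LK] by (simp add: X_def)
  also have "\<dots> = W ** diag_real (\<lambda>i. ln (x i) - \<kappa> i) ** adjoint_mat W"
  proof -
    have "diag_real (\<lambda>i. ln (x i) - \<kappa> i) = diag_real (\<lambda>i. ln (x i)) - diag_real \<kappa>"
      by (simp add: vec_eq_iff diag_real_def)
    then show ?thesis unfolding herm_fun_diag[OF W XW] by (subst KW) (simp add: matrix_diff_distrib)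
  qed
  finally have "herm_exp L = W ** diag_real (\<lambda>i. x i / w (p i)) ** adjoint_mat W"
    by (simp add: herm_fun_diag[OF W] exp_diff \<kappa> x)
  \<comment> \<open>Inserting \<open>inv p (p i)\<close> makes every argument depend on
    \<open>p i\<close> alone, so that \<open>esym_permute\<close> can remove
    \<open>p\<close>.\<close>
  then have "phi k (herm_exp L) = root k (esym UNIV k (\<lambda>i. x (inv p (p i)) / w (p i)))"
    using W permutes_inverses[OF p(1)] by (simp add: phi_conj_diag)
  also have "\<dots> = root k (esym UNIV k (\<lambda>i. x (inv p i) / w i))"
    using esym_permute[OF p(1), of k "\<lambda>i. x (inv p i) / w i"] by simp
  also have "\<dots> \<le> (\<Sum>i\<in>UNIV. w i * (x (inv p i) / w i))"
    by (rule dual) (simp add: x w)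
  also have "\<dots> = (\<Sum>i\<in>UNIV. x (inv p i))"
    using w by (simp add: less_imp_neq[OF w, symmetric])
  also have "\<dots> = (\<Sum>i\<in>UNIV. x i)"
    using sum.permute[OF permutes_inv[OF p(1)], of x] by (simp add: o_def)
  also have "\<dots> = f V" by (simp add: f_def trace_conj_diag[OF W] flip: K_def X_def XW) (simp add: XW trace_conj_diag[OF W])
  also have "\<dots> \<le> f U" using V_min U .
  finally show ?thesis by (simp add: f_def)
qed

subsection \<open>Concavity\<close>

text \<open>The dual matrix is chosen once, for the point where concavity is tested: its trace bound
  is an equality at the combination \<open>C\<close> and an upper bound at \<open>A\<close> and
  \<open>B\<close>. With that matrix fixed, Lieb's theorem compares the three points.\<close>

lemma phi_exp_log_concave:
  fixes H :: "complex^'n^'n" and A B :: "'m::finite \<Rightarrow> complex^'n^'n" and p :: "'m \<Rightarrow> real"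
  assumes k: "1 \<le> k" "k \<le> CARD('n)" and H: "H \<in> Herm"
    and p: "\<And>j. 0 \<le> p j" "(\<Sum>j\<in>UNIV. p j) \<le> 1"
    and AB: "\<And>j. A j \<in> HPD" "\<And>j. B j \<in> HPD" and uv: "0 \<le> u" "0 \<le> v" "u + v = 1"
  shows "u * phi k (herm_exp (H + (\<Sum>j\<in>UNIV. p j *\<^sub>R herm_log (A j))))
      + v * phi k (herm_exp (H + (\<Sum>j\<in>UNIV. p j *\<^sub>R herm_log (B j))))
    \<le> phi k (herm_exp (H + (\<Sum>j\<in>UNIV. p j *\<^sub>R herm_log (u *\<^sub>R A j + v *\<^sub>R B j))))"
proof -
  define S where "S A = (\<Sum>j\<in>UNIV. p j *\<^sub>R herm_log (A j))" for A :: "'m \<Rightarrow> complex^'n^'n"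
  define C where "C j = u *\<^sub>R A j + v *\<^sub>R B j" for j
  have C: "C j \<in> HPD" for j
    unfolding C_def using convexD[OF convex_HPD] AB uv by blast
  have S: "S A \<in> Herm" if "\<And>j. A j \<in> HPD" for A
    unfolding S_def by (intro Herm_sum Herm_scaleR herm_fun_Herm HPD_Herm that)
  obtain V l where V: "unitary_mat V" and l: "H + S C = V ** diag_real l ** adjoint_mat V"
    using spectral_theorem[OF Herm_add[OF H S[OF C]]] .
  \<comment> \<open>The gradient at the eigenvalues \<open>exp (l i)\<close> of
    \<open>herm_exp (H + S C)\<close>, which makes the bound tight there.\<close>
  obtain w where w: "\<And>i. w i > 0" and w_eq: "(\<Sum>i\<in>UNIV. w i * exp (l i)) = root k (esym UNIV k (\<lambda>i. exp (l i)))"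
    and w_le: "\<And>y. (\<And>i. y i > 0) \<Longrightarrow> root k (esym UNIV k y) \<le> (\<Sum>i\<in>UNIV. w i * y i)"
  proof (rule esym_root_supporting_functional[of "UNIV :: 'n set" k "\<lambda>i. exp (l i)"])
    fix w :: "'n \<Rightarrow> real"
    assume "\<And>i. i \<in> UNIV \<Longrightarrow> w i > 0" "(\<Sum>i\<in>UNIV. w i * exp (l i)) = root k (esym UNIV k (\<lambda>i. exp (l i)))"
      "\<And>y. (\<And>i. i \<in> UNIV \<Longrightarrow> y i > 0) \<Longrightarrow> root k (esym UNIV k y) \<le> (\<Sum>i\<in>UNIV. w i * y i)"
    then show ?thesis using that[of w] by simp
  qed (use k in simp_all)
  \<comment> \<open>The logarithm of the dual matrix, in the eigenbasis of \<open>H + S C\<close> so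
    that the two commute. As a fixed Hermitian matrix it is absorbed into \<open>H\<close> when
    Lieb's theorem is applied.\<close>
  define K where "K = V ** diag_real (\<lambda>i. ln (w i)) ** adjoint_mat V"
  have K: "K \<in> Herm" unfolding K_def by (intro Herm_conj Herm_diag_real)
  have le: "phi k (herm_exp (H + S A)) \<le> Re (trace (herm_exp (H + K + S A)))" if "\<And>j. A j \<in> HPD" for A
    using phi_exp_le_trace_exp[OF Herm_add[OF H S[OF that]] V w w_le] by (simp add: K_def add_ac)
  have eq: "phi k (herm_exp (H + S C)) = Re (trace (herm_exp (H + K + S C)))"
  proof -
    have "diag_real (\<lambda>i. l i + ln (w i)) = diag_real l + diag_real (\<lambda>i. ln (w i))"
      by (simp add: vec_eq_iff diag_real_def)
    then have "H + K + S C = V ** diag_real (\<lambda>i. l i + ln (w i)) ** adjoint_mat V"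
      using l by (simp add: K_def matrix_add_ldistrib matrix_add_rdistrib algebra_simps)
    then have "Re (trace (herm_exp (H + K + S C))) = (\<Sum>i\<in>UNIV. w i * exp (l i))"
      using w by (simp add: herm_fun_diag[OF V] trace_conj_diag[OF V] exp_add mult.commute)
    also have "\<dots> = phi k (herm_exp (H + S C))"
      using l by (simp add: herm_fun_diag[OF V] phi_conj_diag[OF V] w_eq)
    finally show ?thesis by simp
  qed
  have "u * phi k (herm_exp (H + S A)) + v * phi k (herm_exp (H + S B))
      \<le> u * Re (trace (herm_exp (H + K + S A))) + v * Re (trace (herm_exp (H + K + S B)))"
    using uv le AB by (intro add_mono mult_left_mono) auto
  also have "\<dots> \<le> Re (trace (herm_exp (H + K + S C)))"
    unfolding S_def C_def by (rule lieb_concavity[OF Herm_add[OF H K] p AB uv])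
  finally show ?thesis unfolding eq[symmetric] by (simp add: S_def C_def)
qed

theorem theorem3p3:
  fixes H :: "complex^'n^'n" and k :: nat
  assumes "1 \<le> k" and "k \<le> CARD('n)" and "H \<in> Herm"
  shows "(\<forall>p :: 'm::finite \<Rightarrow> real.
            (\<forall>j. p j \<in> {0..1}) \<and> (\<Sum>j\<in>UNIV. p j) \<le> 1 \<longrightarrow>
            concave_on {A :: complex^'n^'n^'m. \<forall>j. A $ j \<in> HPD}
              (\<lambda>A. phi k (herm_exp (H + (\<Sum>j\<in>UNIV. p j *\<^sub>R herm_log (A $ j))))))
         \<and> concave_on HPD (\<lambda>A. phi k (herm_exp (H + herm_log A)))"
proof (intro conjI allI impI)
  fix p :: "'m \<Rightarrow> real"
  assume p: "(\<forall>j. p j \<in> {0..1}) \<and> (\<Sum>j\<in>UNIV. p j) \<le> 1"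
  show "concave_on {A :: complex^'n^'n^'m. \<forall>j. A $ j \<in> HPD}
      (\<lambda>A. phi k (herm_exp (H + (\<Sum>j\<in>UNIV. p j *\<^sub>R herm_log (A $ j)))))"
    unfolding concave_on_iff
  proof (intro conjI ballI allI impI)
    show "convex {A :: complex^'n^'n^'m. \<forall>j. A $ j \<in> HPD}"
      by (rule convexI) (simp add: convexD[OF convex_HPD])
  qed (use phi_exp_log_concave[OF assms, of p] p in auto)
next
  \<comment> \<open>The single-matrix case is the family indexed by the one-element type
    \<open>unit\<close> with weight 1.\<close>
  show "concave_on HPD (\<lambda>A. phi k (herm_exp (H + herm_log A)))"
    unfolding concave_on_iff
    using phi_exp_log_concave[OF assms, of "\<lambda>_::unit. 1" "\<lambda>_. A" "\<lambda>_. B" for A B]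
    by (auto simp: convex_HPD UNIV_unit)
qed

end
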